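(* Let $d\ge 1$, $T>0$, $\Omega=(0,1)$, and let $L,H,\Phi,\Psi$ satisfy the standing assumptions (listed in the context), including the smallness condition on $T$. Let $X_*\in L^2((0,1);\mathbb{R}^d)\cap C^1([0,1];\mathbb{R}^d)$ be non-atomic, i.e. $\{\omega\in\Omega: X_*(\omega)=q\}$ has Lebesgue measure zero for every $q\in\mathbb{R}^d$. Then the mean field game with terminal configuration $X_*$ admits a unique Nash equilibrium.
   Context: Standing assumptions. $L,H\in C^3(\mathbb{R}^{2d})$, written $L(q,v)$ and $H(q,p)$ with $q,v,p\in\mathbb{R}^d$, are Legendre transforms of each other in the second variable: $H(q,p)=\sup_v\{\langle v,p\rangle-L(q,v)\}$ and $L(q,v)=\sup_p\{\langle v,p\rangle-H(q,p)\}$. $L\ge 0$, and there are $c_0,c_1>0$ with $c_0|v|^2\le L(q,v)$ and $|\nabla_qL(q,v)|\le c_1$ for all $q,v$. There is $\lambda_0>0$ such that for all $q_0,q_1,v_0,v_1\in\mathbb{R}^d$ and $\varepsilon\in[0,1]$, $\lambda_0|v_1-v_0|^2\le\frac{d^2}{d\varepsilon^2}L((1-\varepsilon)q_0+\varepsilon q_1,(1-\varepsilon)v_0+\varepsilon v_1)$. $\Phi,\Psi\in C^3(\mathbb{R}^d)$ are real-valued, even, bounded from below, with bounded first, second and third derivatives, and $c_\Phi,c_\Psi\in\mathbb{R}$ satisfy $c_\Phi I_d\le\nabla^2\Phi$, $c_\Psi I_d\le\nabla^2\Psi$. With $c^-=\max\{-c,0\}$, the smallness condition on $T$ is $$T^2\left(c_\Phi^-+2\|\nabla^2\Phi\|_{L^\infty}\right)+T\left(c_\Psi^-+2\|\nabla^2\Psi\|_{L^\infty}\right)<\frac{\lambda_0}{2}.$$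 $\mathbb{H}=L^2((0,1);\mathbb{R}^d)$ (Lebesgue measure), and it is part of the setting that $\hat L(X,V)=\int_\Omega L(X(\omega),V(\omega))\,d\omega+\frac12\int_{\Omega^2}\Phi(X(\omega)-X(\tilde\omega))\,d\omega\,d\tilde\omega$ is a real-valued functional on $\mathbb{H}^2$. The game. Players are labelled by $\omega\in\Omega$; the player with label $\omega_0$ has prescribed terminal position $q=X_*(\omega_0)$. A collective control is a measurable $\alpha:[0,T]\times\Omega\to\mathbb{R}^d$ with $\int_0^T\int_\Omega|\alpha|^2\,d\omega\,dt<\infty$ and $\alpha(\cdot,\omega)$ integrable for every $\omega$; its trajectories are $X^\alpha(t,\omega)=X_*(\omega)-\int_t^T\alpha(s,\omega)\,ds$, so $\dot X^\alpha=\alpha$ and $X^\alpha(T,\cdot)=X_*$. Controls that, for each $\omega$, agree for a.e. $t$ are identified. Given $\omega_0\in\Omega$, $q=X_*(\omega_0)$, and a measurable (integrable) $A:[0,T]\to\mathbb{R}^d$, let $\alpha^A(t,\omega)=A(t)$ if $X_*(\omega)=X_*(\omega_0)$ and $\alpha^A(t,\omega)=\alpha(t,\omega)$ otherwise (player $q$ switches to control $A$, all others keep $\alpha$). The cost of player $q$ is $$J[T,q,A,\alpha^A]=\int_0^TL\big(X^{\alpha^A}(t,\omega_0),\alpha^A(t,\omega_0)\big)dt+\int_0^T\!\!\int_\Omega\Phi\big(X^{\alpha^A}(t,\omega_0)-X^{\alpha^A}(t,\omega)\big)d\omega\,dt+\int_\Omega\Psi\big(X^{\alpha^A}(0,\omega_0)-X^{\alpha^A}(0,\omega)\big)d\omega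 .$$ A collective control $\alpha$ is a Nash equilibrium if $J[T,q,\alpha(\cdot,\omega_0),\alpha]\le J[T,q,A,\alpha^A]$ for every $\omega_0\in\Omega$, $q=X_*(\omega_0)$, and every such $A$. *)

theory Defs
  imports "HOL-Analysis.Analysis" "HOL-Probability.Essential_Supremum"
begin

subsection \<open>Derivatives\<close>

definition dir_deriv ::
  "'a::real_normed_vector \<Rightarrow> ('a \<Rightarrow> 'b::real_normed_vector) \<Rightarrow> 'a \<Rightarrow> 'b"
  where "dir_deriv b f x = frechet_derivative f (at x) b"

text \<open>\<open>Ck k f\<close>: \<open>f\<close> is of class \<open>C\<^sup>k\<close> on the whole space.\<close>

fun Ck :: "nat \<Rightarrow> ('a::euclidean_space \<Rightarrow> 'b::real_normed_vector) \<Rightarrow> bool" where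
  "Ck 0 f \<longleftrightarrow> continuous_on UNIV f"
| "Ck (Suc k) f \<longleftrightarrow> (\<forall>x. f differentiable (at x)) \<and> (\<forall>b\<in>Basis. Ck k (dir_deriv b f))"

text \<open>For a list \<open>bs\<close> of basis vectors, \<open>foldr dir_deriv bs f\<close> is the corresponding
  iterated partial derivative of order \<open>length bs\<close>.\<close>

definition bounded_derivs_upto :: "nat \<Rightarrow> ('a::euclidean_space \<Rightarrow> real) \<Rightarrow> bool" where
  "bounded_derivs_upto k f \<longleftrightarrow>
     (\<forall>bs. set bs \<subseteq> Basis \<and> 1 \<le> length bs \<and> length bs \<le> k
        \<longrightarrow> bounded (range (foldr dir_deriv bs f)))"

definition grad :: "('a::euclidean_space \<Rightarrow> real) \<Rightarrow> 'a \<Rightarrow> 'a" where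
  "grad f x = (THE D. GDERIV f x :> D)"

definition hess :: "('a::euclidean_space \<Rightarrow> real) \<Rightarrow> 'a \<Rightarrow> 'a \<Rightarrow> 'a" where
  "hess f x = frechet_derivative (grad f) (at x)"

text \<open>\<open>c I \<le> \<nabla>\<^sup>2f\<close> in the sense of quadratic forms.\<close>

definition hess_ge :: "real \<Rightarrow> ('a::euclidean_space \<Rightarrow> real) \<Rightarrow> bool" where
  "hess_ge c f \<longleftrightarrow> (\<forall>x v. c * (v \<bullet> v) \<le> hess f x v \<bullet> v)"

text \<open>The \<open>L\<^sup>\<infinity>\<close> norm of the Hessian; the pointwise norm is the operator norm induced by the
  Euclidean norm.\<close>

definition hess_Linfty :: "('a::euclidean_space \<Rightarrow> real) \<Rightarrow> ereal" where
  "hess_Linfty f = esssup lborel (\<lambda>x. ereal (onorm (hess f x)))"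

definition neg_part :: "real \<Rightarrow> real" where
  "neg_part c = max (- c) 0"

text \<open>One-sided derivatives at the end points, so that the values of the function outside
  \<open>[0,1]\<close> play no role (unlike in \<open>C1_differentiable_on\<close>).\<close>

definition C1_unit_interval :: "(real \<Rightarrow> 'a::real_normed_vector) \<Rightarrow> bool" where
  "C1_unit_interval X \<longleftrightarrow>
     (\<exists>D. (\<forall>s\<in>{0..1}. (X has_vector_derivative D s) (at s within {0..1})) \<and>
          continuous_on {0..1} D)"


subsection \<open>The functional setting\<close>

text \<open>In \<open>legendre_snd F G\<close> the supremum is taken in the extended reals, so it is in
  particular asserted to be finite.\<close>

definition legendre_snd ::
  "('a \<times> 'b::real_inner \<Rightarrow> real) \<Rightarrow> ('a \<times> 'b \<Rightarrow> real) \<Rightarrow> bool" where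
  "legendre_snd F G \<longleftrightarrow>
     (\<forall>q p. ereal (G (q, p)) = (SUP v. ereal (v \<bullet> p - F (q, v))))"

abbreviation players :: "real set" where
  "players \<equiv> {0<..<1}"

definition L2_players :: "(real \<Rightarrow> 'a::euclidean_space) \<Rightarrow> bool" where
  "L2_players X \<longleftrightarrow>
     X \<in> borel_measurable (lebesgue_on players) \<and>
     integrable (lebesgue_on players) (\<lambda>\<omega>. (norm (X \<omega>))\<^sup>2)"

text \<open>The functional
  \<open>(X,V) \<mapsto> \<integral> L(X(\<omega>),V(\<omega>)) d\<omega> + 1/2 \<integral>\<integral> \<Phi>(X(\<omega>)-X(\<omega>')) d\<omega> d\<omega>'\<close>
  is real valued on pairs of square integrable functions. As both integrands are bounded
  from below, this means that both are integrable.\<close>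

definition lifted_lagrangian_finite ::
  "('a::euclidean_space \<times> 'a \<Rightarrow> real) \<Rightarrow> ('a \<Rightarrow> real) \<Rightarrow> bool" where
  "lifted_lagrangian_finite L \<Phi> \<longleftrightarrow>
     (\<forall>X V. L2_players X \<and> L2_players V \<longrightarrow>
        integrable (lebesgue_on players) (\<lambda>\<omega>. L (X \<omega>, V \<omega>)) \<and>
        integrable (lebesgue_on players \<Otimes>\<^sub>M lebesgue_on players)
          (\<lambda>(\<omega>, \<omega>'). \<Phi> (X \<omega> - X \<omega>')))"


subsection \<open>The game\<close>

text \<open>Collective controls are curried functions \<open>\<alpha> t \<omega>\<close>; only their values on
  \<open>[0,T] \<times> (0,1)\<close> matter.\<close>

definition collective_control :: "real \<Rightarrow> (real \<Rightarrow> real \<Rightarrow> 'a::euclidean_space) \<Rightarrow> bool" where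
  "collective_control T \<alpha> \<longleftrightarrow>
     (\<lambda>(t, \<omega>). \<alpha> t \<omega>) \<in> borel_measurable (lebesgue_on ({0..T} \<times> players)) \<and>
     integrable (lebesgue_on ({0..T} \<times> players)) (\<lambda>(t, \<omega>). (norm (\<alpha> t \<omega>))\<^sup>2) \<and>
     (\<forall>\<omega>\<in>players. set_integrable lebesgue {0..T} (\<lambda>t. \<alpha> t \<omega>))"

definition control_equiv ::
  "real \<Rightarrow> (real \<Rightarrow> real \<Rightarrow> 'a) \<Rightarrow> (real \<Rightarrow> real \<Rightarrow> 'a) \<Rightarrow> bool" where
  "control_equiv T \<alpha> \<beta> \<longleftrightarrow>
     (\<forall>\<omega>\<in>players. AE t in lebesgue_on {0..T}. \<alpha> t \<omega> = \<beta> t \<omega>)"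

definition traj ::
  "real \<Rightarrow> (real \<Rightarrow> 'a::euclidean_space) \<Rightarrow> (real \<Rightarrow> real \<Rightarrow> 'a) \<Rightarrow> real \<Rightarrow> real \<Rightarrow> 'a" where
  "traj T Xs \<alpha> t \<omega> = Xs \<omega> - (LINT s:{t..T}|lebesgue. \<alpha> s \<omega>)"

text \<open>The player with label \<open>\<omega>0\<close> switches to the control \<open>A\<close>.\<close>

definition deviate ::
  "(real \<Rightarrow> 'a) \<Rightarrow> (real \<Rightarrow> real \<Rightarrow> 'a) \<Rightarrow> real \<Rightarrow> (real \<Rightarrow> 'a) \<Rightarrow> real \<Rightarrow> real \<Rightarrow> 'a" where
  "deviate Xs \<alpha> \<omega>0 A = (\<lambda>t \<omega>. if Xs \<omega> = Xs \<omega>0 then A t else \<alpha> t \<omega>)"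

text \<open>\<open>cost L \<Phi> \<Psi> T Xs \<omega>0 \<beta>\<close> is the cost of the player with label \<open>\<omega>0\<close> when \<open>\<beta>\<close> is the
  collective control actually played, i.e. \<open>J[T, Xs \<omega>0, \<beta>(\<cdot>,\<omega>0), \<beta>]\<close>. An individual control
  that is merely integrable may have infinite running cost; as \<open>L \<ge> 0\<close>, that term is taken in
  \<open>[0,\<infinity>]\<close>. The two interaction terms are finite for every collective control, since
  \<open>\<Phi>\<close> and \<open>\<Psi>\<close> are Lipschitz.\<close>

definition cost ::
  "('a::euclidean_space \<times> 'a \<Rightarrow> real) \<Rightarrow> ('a \<Rightarrow> real) \<Rightarrow> ('a \<Rightarrow> real) \<Rightarrow> real \<Rightarrow>
   (real \<Rightarrow> 'a) \<Rightarrow> real \<Rightarrow> (real \<Rightarrow> real \<Rightarrow> 'a) \<Rightarrow> ereal" where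
  "cost L \<Phi> \<Psi> T Xs \<omega>0 \<beta> =
     enn2ereal (\<integral>\<^sup>+t\<in>{0..T}. ennreal (L (traj T Xs \<beta> t \<omega>0, \<beta> t \<omega>0)) \<partial>lebesgue) +
     ereal (LINT t:{0..T}|lebesgue. LINT \<omega>:players|lebesgue.
              \<Phi> (traj T Xs \<beta> t \<omega>0 - traj T Xs \<beta> t \<omega>)) +
     ereal (LINT \<omega>:players|lebesgue. \<Psi> (traj T Xs \<beta> 0 \<omega>0 - traj T Xs \<beta> 0 \<omega>))"

definition nash_equilibrium ::
  "('a::euclidean_space \<times> 'a \<Rightarrow> real) \<Rightarrow> ('a \<Rightarrow> real) \<Rightarrow> ('a \<Rightarrow> real) \<Rightarrow> real \<Rightarrow>
   (real \<Rightarrow> 'a) \<Rightarrow> (real \<Rightarrow> real \<Rightarrow> 'a) \<Rightarrow> bool" where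
  "nash_equilibrium L \<Phi> \<Psi> T Xs \<alpha> \<longleftrightarrow>
     collective_control T \<alpha> \<and>
     (\<forall>\<omega>0\<in>players. \<forall>A. set_integrable lebesgue {0..T} A \<longrightarrow>
        cost L \<Phi> \<Psi> T Xs \<omega>0 \<alpha> \<le> cost L \<Phi> \<Psi> T Xs \<omega>0 (deviate Xs \<alpha> \<omega>0 A))"

end

(*
  A player facing a given flow of the crowd minimises a cost that is strongly convex in the
  control: the convexity lam of L in the velocity beats the convexity defects of \<Phi> and \<Psi>,
  because trajectories with common end point satisfy |y(t)|^2 \<le> T \<integral>|y'|^2. Hence best responses
  exist (minimising sequences are Cauchy in L^2), are unique, and depend continuously on the
  terminal position. Adding the strong convexity inequalities for two crowd flows, L cancels
  and only second differences of \<Phi>, \<Psi> remain; so the best response is a contraction in the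
  crowd flow, with factor 2/3. By non-atomicity a deviation does not change the crowd,
  so Nash equilibria are exactly the fixed points.
*)

theory Submission
  imports Defs
begin

subsection \<open>Integration\<close>

text \<open>Two measurability obstacles shape the development. The fixed point yields an optimal
  control for each label separately, while a collective control must be jointly measurable in
  \<open>t\<close> and \<open>\<omega>\<close>; Hoelder dependence of the optimal control on the
  terminal position repairs this. Conversely, a given collective control is measurable only for the
  completed product measure, so measurability of its trajectories in \<open>\<omega>\<close> needs a
  suitable form of Fubini.

  The contraction is used in two norms. For existence the crowd flow ranges over bounded continuous
  functions of \<open>(t, \<omega>)\<close>, a complete space. Trajectories of an arbitrary
  equilibrium are at first only dominated by an integrable function of \<open>\<omega>\<close>, so
  uniqueness uses the supremum over \<open>t\<close> of the L^1 distance in \<open>\<omega>\<close>.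
  Optimal controls are therefore compared through a crowd distance averaged over labels, which both
  norms dominate.

  Convexity enters through midpoints of two controls, in place of the Euler-Lagrange equation. One
  bound on mixed second differences of a potential controls both its convexity defect and its
  reaction to a changed crowd.\<close>

lemma AE_summable_of_summable_integrals:
  fixes g :: "nat \<Rightarrow> 'a \<Rightarrow> real"
  assumes int: "\<And>n. integrable M (g n)" and pos: "\<And>n x. 0 \<le> g n x"
    and sum: "summable (\<lambda>n. \<integral>x. g n x \<partial>M)"
  shows "AE x in M. summable (\<lambda>n. g n x)"
proof -
  have [measurable]: "g n \<in> borel_measurable M" for n using int by auto
  have "(\<integral>\<^sup>+x. (\<Sum>n. ennreal (g n x)) \<partial>M) = (\<Sum>n. \<integral>\<^sup>+x. ennreal (g n x) \<partial>M)"
    by (rule nn_integral_suminf) simp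
  also have "\<dots> = (\<Sum>n. ennreal (\<integral>x. g n x \<partial>M))"
    by (intro suminf_cong nn_integral_eq_integral int) (simp add: pos)
  also have "\<dots> = ennreal (\<Sum>n. \<integral>x. g n x \<partial>M)"
    by (intro suminf_ennreal2 sum integral_nonneg) (simp add: pos)
  finally have "(\<integral>\<^sup>+x. (\<Sum>n. ennreal (g n x)) \<partial>M) \<noteq> \<infinity>" by simp
  then have "AE x in M. (\<Sum>n. ennreal (g n x)) \<noteq> \<infinity>"
    by (intro nn_integral_PInf_AE) auto
  then show ?thesis
    by eventually_elim (rule summable_suminf_not_top, auto simp: pos)
qed

lemma AE_tendsto_of_summable_L1:
  fixes f :: "nat \<Rightarrow> 'a \<Rightarrow> 'b::{banach, second_countable_topology}"
  assumes "\<And>n. integrable M (f n)" "integrable M F"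
    and "summable (\<lambda>n. \<integral>x. norm (f n x - F x) \<partial>M)"
  shows "AE x in M. (\<lambda>n. f n x) \<longlonglongrightarrow> F x"
proof -
  have "AE x in M. summable (\<lambda>n. norm (f n x - F x))"
    using assms by (intro AE_summable_of_summable_integrals) auto
  then show ?thesis
  proof eventually_elim
    case (elim x)
    then have "(\<lambda>n. norm (f n x - F x)) \<longlonglongrightarrow> 0" by (rule summable_LIMSEQ_zero)
    then have "(\<lambda>n. f n x - F x) \<longlonglongrightarrow> 0" by (rule tendsto_norm_zero_cancel)
    then show ?case by (rule LIM_zero_cancel)
  qed
qed

text \<open>Summable increments spare the passage to a subsequence: the telescoping series converges
  absolutely almost everywhere, and the sum of the norms of all increments dominates every
  remainder, which gives the L^1 limit as well.\<close>

lemma L1_fast_Cauchy_limit: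
  fixes f :: "nat \<Rightarrow> 'a \<Rightarrow> 'b::{banach, second_countable_topology}"
  assumes int: "\<And>n. integrable M (f n)"
    and sum: "summable (\<lambda>n. \<integral>x. norm (f (Suc n) x - f n x) \<partial>M)"
  obtains F where "integrable M F" "AE x in M. (\<lambda>n. f n x) \<longlonglongrightarrow> F x"
    "(\<lambda>n. \<integral>x. norm (f n x - F x) \<partial>M) \<longlonglongrightarrow> 0"
proof -
  define d where "d n x = f (Suc n) x - f n x" for n x
  have dint: "integrable M (d n)" for n unfolding d_def using int by auto
  have dsum: "summable (\<lambda>n. \<integral>x. norm (d n x) \<partial>M)" using sum by (simp add: d_def)
  have ae: "AE x in M. summable (\<lambda>n. norm (d n x))"
    using dint dsum by (intro AE_summable_of_summable_integrals) auto
  define R where "R x = (\<Sum>n. d n x)" for x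
  have Rint: "integrable M R"
    unfolding R_def by (rule integrable_suminf[OF dint ae dsum])
  define F where "F x = f 0 x + R x" for x
  have Fint: "integrable M F" unfolding F_def using int Rint by auto
  have part: "(\<Sum>k<n. d k x) = f n x - f 0 x" for n x
    by (induction n) (auto simp: d_def)
  have ae_lim: "AE x in M. (\<lambda>n. f n x) \<longlonglongrightarrow> F x"
    using ae
  proof eventually_elim
    case (elim x)
    then have "(\<lambda>n. d n x) sums R x"
      unfolding R_def by (rule summable_sums[OF summable_norm_cancel])
    then have "(\<lambda>n. f n x - f 0 x) \<longlonglongrightarrow> R x" by (simp add: sums_def part)
    then have "(\<lambda>n. (f n x - f 0 x) + f 0 x) \<longlonglongrightarrow> R x + f 0 x" by (intro tendsto_intros)
    then show ?case by (simp add: F_def add.commute)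
  qed
  define w where "w x = (\<Sum>n. norm (d n x))" for x
  have wint: "integrable M w"
    unfolding w_def using dint ae dsum by (intro integrable_suminf) auto
  have bound: "AE x in M. norm (norm (f n x - F x)) \<le> w x" for n
    using ae
  proof eventually_elim
    case (elim x)
    have sd: "summable (\<lambda>n. d n x)" by (rule summable_norm_cancel[OF elim])
    have "F x - f n x = (\<Sum>k. d (k + n) x)"
      using suminf_split_initial_segment[OF sd, of n] by (simp add: F_def R_def part)
    also have "norm \<dots> \<le> (\<Sum>k. norm (d (k + n) x))"
      by (intro summable_norm summable_ignore_initial_segment[OF elim])
    also have "\<dots> \<le> w x"
      unfolding w_def using suminf_split_initial_segment[OF elim, of n]
      by (simp add: sum_nonneg)
    finally show ?case by (simp add: norm_minus_commute)
  qed
  have "(\<lambda>n. \<integral>x. norm (f n x - F x) \<partial>M) \<longlonglongrightarrow> (\<integral>x. 0 \<partial>M)"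
  proof (rule integral_dominated_convergence[OF _ _ wint])
    show "AE x in M. (\<lambda>n. norm (f n x - F x)) \<longlonglongrightarrow> 0"
      using ae_lim by eventually_elim (intro tendsto_norm_zero LIM_zero)
  qed (use int Fint bound in auto)
  then show ?thesis using that Fint ae_lim by auto
qed

text \<open>Cauchy-Schwarz against the constant function 1, read off from the integral of the square
  of \<open>V * norm (f x) - I\<close>. This yields \<open>V\<close> times the claim, so total mass
  zero is a separate case.\<close>

lemma (in finite_measure) integral_norm_square_le:
  fixes f :: "'a \<Rightarrow> 'b::{banach, second_countable_topology}"
  assumes f: "integrable M f" and f2: "integrable M (\<lambda>x. (norm (f x))\<^sup>2)"
  shows "(\<integral>x. norm (f x) \<partial>M)\<^sup>2 \<le> measure M (space M) * (\<integral>x. (norm (f x))\<^sup>2 \<partial>M)"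
proof -
  define V where "V = measure M (space M)"
  define I where "I = (\<integral>x. norm (f x) \<partial>M)"
  define Q where "Q = (\<integral>x. (norm (f x))\<^sup>2 \<partial>M)"
  have V: "0 \<le> V" by (simp add: V_def)
  have "0 \<le> (\<integral>x. (V * norm (f x) - I)\<^sup>2 \<partial>M)" by simp
  also have "\<dots> = (\<integral>x. V\<^sup>2 * (norm (f x))\<^sup>2 - (2 * V * I) * norm (f x) + I\<^sup>2 \<partial>M)"
    by (intro Bochner_Integration.integral_cong) (auto simp: power2_eq_square algebra_simps)
  also have "\<dots> = V\<^sup>2 * Q - (2 * V * I) * I + V * I\<^sup>2"
    using f f2 by (simp add: V_def I_def Q_def)
  also have "\<dots> = V * (V * Q - I\<^sup>2)" by (simp add: power2_eq_square algebra_simps)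
  finally have *: "0 \<le> V * (V * Q - I\<^sup>2)" .
  show ?thesis
  proof (cases "V = 0")
    case True
    then have "emeasure M (space M) = 0" by (simp add: V_def emeasure_eq_measure)
    then have "AE x in M. norm (f x) = 0"
      by (intro AE_I[of _ _ "space M"]) auto
    then have "I = 0" unfolding I_def by (rule integral_eq_zero_AE)
    then show ?thesis using True by (simp add: V_def I_def)
  next
    case False
    then have "0 \<le> V * Q - I\<^sup>2" using * V by (simp add: zero_le_mult_iff)
    then show ?thesis by (simp add: V_def I_def Q_def)
  qed
qed

section \<open>Borel versions and iterated integrals of Lebesgue measurable functions\<close>

lemma ex_borel_version:
  fixes f :: "'a \<Rightarrow> 'b::euclidean_space"
  assumes "f \<in> borel_measurable (completion M)"
  shows "\<exists>g\<in>borel_measurable M. AE x in M. f x = g x"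
proof -
  have "\<exists>g\<in>borel_measurable M. AE x in M. f x \<bullet> b = g x" for b
    using assms by (intro completion_ex_borel_measurable_real borel_measurable_inner) auto
  then obtain g where g: "\<And>b. g b \<in> borel_measurable M" and ae: "\<And>b. AE x in M. f x \<bullet> b = g b x"
    by metis
  show ?thesis
  proof (intro bexI)
    show "(\<lambda>x. \<Sum>b\<in>Basis. g b x *\<^sub>R b) \<in> borel_measurable M" using g by simp
    have "AE x in M. \<forall>b\<in>Basis. f x \<bullet> b = g b x" by (intro AE_finite_allI ae) simp
    then show "AE x in M. f x = (\<Sum>b\<in>Basis. g b x *\<^sub>R b)"
    proof eventually_elim
      case (elim x)
      have "f x = (\<Sum>b\<in>Basis. (f x \<bullet> b) *\<^sub>R b)" by (simp add: euclidean_representation)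
      then show ?case using elim by simp
    qed
  qed
qed

lemma ex_borel_version_lebesgue_on:
  fixes f :: "'a::euclidean_space \<Rightarrow> 'b::euclidean_space"
  assumes f: "f \<in> borel_measurable (lebesgue_on S)" and S: "S \<in> sets lebesgue"
  shows "\<exists>g\<in>borel_measurable borel. AE x in lebesgue_on S. f x = g x"
proof -
  have "(\<lambda>x. if x \<in> S then f x else 0) \<in> borel_measurable lebesgue"
    using f S by (rule borel_measurable_if_I)
  then obtain g where g: "g \<in> borel_measurable lborel"
    and ae: "AE x in lborel. (if x \<in> S then f x else 0) = g x"
    using ex_borel_version by blast
  have "AE x in lebesgue. x \<in> S \<longrightarrow> f x = g x"
    using AE_completion[OF ae] by eventually_elim auto
  then have "AE x in lebesgue_on S. f x = g x"
    using S by (simp add: AE_restrict_space_iff)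
  with g show ?thesis by auto
qed

text \<open>Fubini for a function that is only measurable with respect to the completed product
  measure: single sections may fail to be measurable, but almost all of them are.\<close>

lemma integrable_section_integral:
  fixes f :: "real \<times> real \<Rightarrow> 'a::euclidean_space"
  assumes U: "U \<in> sets borel" and V: "V \<in> sets borel" and f: "integrable (lebesgue_on (U \<times> V)) f"
  shows "integrable (lebesgue_on V) (\<lambda>y. \<integral>x. f (x, y) \<partial>lebesgue_on U)"
proof -
  have U': "U \<in> sets lebesgue" and V': "V \<in> sets lebesgue" using U V by auto
  have "U \<times> V \<in> sets borel"
    using pair_measureI[OF U V] unfolding borel_prod .
  then have UV: "U \<times> V \<in> sets lebesgue" by auto
  define F where "F p = (if p \<in> U \<times> V then f p else 0)" for p
  have F: "integrable lebesgue F"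
    unfolding F_def using f Lebesgue_Measure.integrable_restrict_UNIV[OF UV, of f] by blast
  obtain G where G: "G \<in> borel_measurable lborel" and FG: "AE p in lborel. F p = G p"
    using ex_borel_version[OF borel_measurable_integrable[OF F]] by blast
  have "integrable lebesgue G"
    using F G AE_completion[OF FG] by (subst integrable_cong_AE[of _ _ F]) (auto simp: measurable_completion)
  then have Gi: "integrable (lborel \<Otimes>\<^sub>M lborel) (case_prod (\<lambda>x y. G (x, y)))"
    using G by (simp add: integrable_completion lborel_prod)
  have k: "integrable lborel (\<lambda>y. \<integral>x. G (x, y) \<partial>lborel)"
    by (rule lborel_pair.integrable_snd[OF Gi])
  \<comment> \<open>The set where \<open>F\<close> and \<open>G\<close> differ need not be Borel.
    Exchanging the two almost-everywhere quantifiers needs a measurable set, hence the Borel null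
    set \<open>N\<close> around it.\<close>
  obtain N where N: "N \<in> null_sets lborel" "{p. F p \<noteq> G p} \<subseteq> N"
    using FG by (auto simp: eventually_ae_filter)
  have NF: "F p = G p" if "p \<notin> N" for p using N(2) that by auto
  have "AE p in lborel \<Otimes>\<^sub>M lborel. p \<notin> N"
    using N(1) by (simp add: lborel_prod AE_not_in)
  then have "AE x in lborel. AE y in lborel. (x, y) \<notin> N"
    by (rule lborel_pair.AE_pair)
  moreover have "{p \<in> space (lborel \<Otimes>\<^sub>M lborel). (fst p, snd p) \<notin> N} \<in> sets (lborel \<Otimes>\<^sub>M lborel)"
  proof -
    have "{p \<in> space (lborel \<Otimes>\<^sub>M lborel). (fst p, snd p) \<notin> N} = - N"
      by (auto simp: space_pair_measure)
    moreover have "- N \<in> sets (lborel \<Otimes>\<^sub>M lborel)"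
      unfolding lborel_prod using N(1) by auto
    ultimately show ?thesis by metis
  qed
  ultimately have "AE y in lborel. AE x in lborel. (x, y) \<notin> N"
    using lborel_pair.AE_commute[of "\<lambda>x y. (x, y) \<notin> N"] by auto
  then have ae: "AE y in lborel. (\<integral>x. F (x, y) \<partial>lebesgue) = (\<integral>x. G (x, y) \<partial>lborel)"
  proof eventually_elim
    case (elim y)
    have Gy: "(\<lambda>x. G (x, y)) \<in> borel_measurable lborel"
      using G by (auto intro: measurable_compose[where g = G])
    have FGy: "AE x in lebesgue. G (x, y) = F (x, y)"
      using AE_completion[OF elim] by eventually_elim (simp add: NF)
    have Fy: "(\<lambda>x. F (x, y)) \<in> borel_measurable lebesgue"
      by (rule borel_measurable_AE[OF _ FGy]) (use Gy in \<open>auto simp: measurable_completion\<close>)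
    have "(\<integral>x. F (x, y) \<partial>lebesgue) = (\<integral>x. G (x, y) \<partial>lebesgue)"
      using Fy Gy FGy by (intro integral_cong_AE) (auto simp: measurable_completion)
    also have "\<dots> = (\<integral>x. G (x, y) \<partial>lborel)" using Gy by (simp add: integral_completion)
    finally show ?case .
  qed
  have kc: "integrable lebesgue (\<lambda>y. \<integral>x. G (x, y) \<partial>lborel)"
    using k by (simp add: integrable_completion)
  have ae': "AE y in lebesgue. (\<integral>x. G (x, y) \<partial>lborel) = (\<integral>x. F (x, y) \<partial>lebesgue)"
    using AE_completion[OF ae] by eventually_elim simp
  have "(\<lambda>y. \<integral>x. F (x, y) \<partial>lebesgue) \<in> borel_measurable lebesgue"
    by (rule borel_measurable_AE[OF borel_measurable_integrable[OF kc] ae'])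
  then have "integrable lebesgue (\<lambda>y. \<integral>x. F (x, y) \<partial>lebesgue)"
    using kc ae' by (subst integrable_cong_AE[of _ _ "\<lambda>y. \<integral>x. G (x, y) \<partial>lborel"]) auto
  moreover have "(\<integral>x. F (x, y) \<partial>lebesgue) = (if y \<in> V then \<integral>x. f (x, y) \<partial>lebesgue_on U else 0)" for y
    using Lebesgue_Measure.integral_restrict_UNIV[OF U', of "\<lambda>x. f (x, y)"] by (auto simp: F_def)
  ultimately show ?thesis
    using V' by (simp add: Lebesgue_Measure.integrable_restrict_UNIV)
qed

lemma nn_integral_lebesgue_on_Times:
  fixes f :: "real \<times> real \<Rightarrow> ennreal"
  assumes U: "U \<in> sets borel" and V: "V \<in> sets borel" and f: "f \<in> borel_measurable borel"
  shows "(\<integral>\<^sup>+p. f p \<partial>lebesgue_on (U \<times> V)) = (\<integral>\<^sup>+y. (\<integral>\<^sup>+x. f (x, y) \<partial>lebesgue_on U) \<partial>lebesgue_on V)"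
proof -
  have U': "U \<in> sets lebesgue" and V': "V \<in> sets lebesgue" using U V by auto
  have UVb: "U \<times> V \<in> sets borel"
    using pair_measureI[OF U V] unfolding borel_prod .
  then have UV: "U \<times> V \<in> sets lebesgue" by auto
  let ?F = "\<lambda>p. f p * indicator (U \<times> V) p"
  have F: "?F \<in> borel_measurable (lborel \<Otimes>\<^sub>M lborel)"
    using f UVb by (simp add: lborel_prod)
  have "(\<integral>\<^sup>+p. f p \<partial>lebesgue_on (U \<times> V)) = (\<integral>\<^sup>+p. ?F p \<partial>lebesgue)"
    using UV by (subst nn_integral_restrict_space) auto
  also have "\<dots> = (\<integral>\<^sup>+p. ?F p \<partial>(lborel \<Otimes>\<^sub>M lborel))" by (simp add: nn_integral_completion lborel_prod)
  also have "\<dots> = (\<integral>\<^sup>+y. (\<integral>\<^sup>+x. ?F (x, y) \<partial>lborel) \<partial>lborel)"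
    by (rule lborel_pair.nn_integral_snd[OF F, symmetric])
  also have "\<dots> = (\<integral>\<^sup>+y. (\<integral>\<^sup>+x. f (x, y) * indicator U x \<partial>lborel) * indicator V y \<partial>lborel)"
    by (intro nn_integral_cong) (auto simp: indicator_def)
  also have "\<dots> = (\<integral>\<^sup>+y. (\<integral>\<^sup>+x. f (x, y) \<partial>lebesgue_on U) \<partial>lebesgue_on V)"
    using U' V' by (simp add: nn_integral_restrict_space nn_integral_completion)
  finally show ?thesis .
qed

subsection \<open>Differentiable functions\<close>

lemma Ck_Suc_continuous: "Ck (Suc k) f \<Longrightarrow> continuous_on UNIV f"
  by (auto simp: continuous_on_eq_continuous_at intro: differentiable_imp_continuous_within)

lemma frechet_derivative_Basis_sum:
  fixes f :: "'a::euclidean_space \<Rightarrow> 'b::real_normed_vector"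
  assumes "f differentiable (at x)"
  shows "frechet_derivative f (at x) v = (\<Sum>b\<in>Basis. (v \<bullet> b) *\<^sub>R dir_deriv b f x)"
proof -
  interpret bounded_linear "frechet_derivative f (at x)"
    using assms frechet_derivative_works has_derivative_bounded_linear by blast
  have "frechet_derivative f (at x) v = frechet_derivative f (at x) (\<Sum>b\<in>Basis. (v \<bullet> b) *\<^sub>R b)"
    by (simp add: euclidean_representation)
  then show ?thesis
    by (simp add: sum scaleR dir_deriv_def)
qed

lemma has_vector_derivative_line:
  fixes f :: "'a::real_normed_vector \<Rightarrow> 'b::real_normed_vector"
  assumes "f differentiable (at (p + e *\<^sub>R w))"
  shows "((\<lambda>e. f (p + e *\<^sub>R w)) has_vector_derivative
           frechet_derivative f (at (p + e *\<^sub>R w)) w) (at e)"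
proof -
  have "(f has_derivative frechet_derivative f (at (p + e *\<^sub>R w))) (at (p + e *\<^sub>R w))"
    using assms frechet_derivative_works by blast
  moreover have "((\<lambda>e. p + e *\<^sub>R w) has_derivative (\<lambda>h. h *\<^sub>R w)) (at e)"
    by (auto intro!: derivative_eq_intros)
  ultimately have d: "((\<lambda>e. f (p + e *\<^sub>R w)) has_derivative
      (\<lambda>h. frechet_derivative f (at (p + e *\<^sub>R w)) (h *\<^sub>R w))) (at e)"
    using has_derivative_compose by blast
  interpret bounded_linear "frechet_derivative f (at (p + e *\<^sub>R w))"
    using assms frechet_derivative_works has_derivative_bounded_linear by blast
  show ?thesis
    using d by (simp add: has_vector_derivative_def scaleR)
qed

lemma has_real_derivative_line:
  fixes f :: "'a::real_normed_vector \<Rightarrow> real"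
  assumes "f differentiable (at (p + e *\<^sub>R w))"
  shows "((\<lambda>e. f (p + e *\<^sub>R w)) has_real_derivative
           frechet_derivative f (at (p + e *\<^sub>R w)) w) (at e)"
  using has_vector_derivative_line[OF assms] by (simp add: has_real_derivative_iff_has_vector_derivative)

text \<open>Subtracting \<open>c * e\<^sup>2 / 2\<close> from the restriction of \<open>L\<close> to
  the segment leaves a function with nonnegative second derivative. Adding its tangent inequalities
  from 1/2 to 0 and to 1 gives the claim; \<open>c / 8\<close> is half of
  \<open>c / 2 - c / 4\<close>.\<close>

lemma midpoint_strong_convexity:
  fixes L :: "'a::euclidean_space \<Rightarrow> real"
  assumes C: "Ck (Suc (Suc k)) L"
    and dd: "\<forall>\<epsilon>\<in>{0..1}. c \<le> deriv (deriv (\<lambda>e. L ((1 - e) *\<^sub>R p0 + e *\<^sub>R p1))) \<epsilon>"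
  shows "L ((1/2) *\<^sub>R (p0 + p1)) \<le> (L p0 + L p1) / 2 - c / 8"
proof -
  define w where "w = p1 - p0"
  define \<phi> where "\<phi> = (\<lambda>e. L (p0 + e *\<^sub>R w))"
  have eq: "(\<lambda>e. L ((1 - e) *\<^sub>R p0 + e *\<^sub>R p1)) = \<phi>"
    by (auto simp: \<phi>_def w_def fun_eq_iff algebra_simps)
  have dL: "L differentiable (at x)" and dL2: "b \<in> Basis \<Longrightarrow> dir_deriv b L differentiable (at x)" for b x
    using C by auto
  have d1: "(\<phi> has_real_derivative frechet_derivative L (at (p0 + e *\<^sub>R w)) w) (at e)" for e
    unfolding \<phi>_def by (intro has_real_derivative_line dL)
  have deriv1: "deriv \<phi> = (\<lambda>e. \<Sum>b\<in>Basis. (w \<bullet> b) * dir_deriv b L (p0 + e *\<^sub>R w))"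
    using DERIV_imp_deriv[OF d1] frechet_derivative_Basis_sum[OF dL] by auto
  \<comment> \<open>\<open>deriv\<close> has a value even where no derivative exists; the hypothesis
    becomes usable only once \<open>deriv \<phi>\<close> is known to be differentiable, here as a
    finite sum of partial derivatives.\<close>
  have "(deriv \<phi> has_real_derivative
      (\<Sum>b\<in>Basis. (w \<bullet> b) * frechet_derivative (dir_deriv b L) (at (p0 + e *\<^sub>R w)) w)) (at e)" for e
    unfolding deriv1 by (intro DERIV_sum DERIV_cmult has_real_derivative_line dL2)
  then have d2: "(deriv \<phi> has_real_derivative deriv (deriv \<phi>) e) (at e)" for e
    by (metis DERIV_imp_deriv)
  define \<psi> where "\<psi> = (\<lambda>e. \<phi> e - c * e\<^sup>2 / 2)"
  define \<psi>' where "\<psi>' = (\<lambda>e. deriv \<phi> e - c * e)"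
  have "(\<psi> has_real_derivative \<psi>' e) (at e)" for e
    unfolding \<psi>_def \<psi>'_def using DERIV_imp_deriv[OF d1]
    by (auto intro!: derivative_eq_intros d1)
  moreover have "(\<psi>' has_real_derivative (deriv (deriv \<phi>) e - c)) (at e)" for e
    unfolding \<psi>'_def by (auto intro!: derivative_eq_intros d2)
  moreover have "0 \<le> deriv (deriv \<phi>) e - c" if "e \<in> {0..1}" for e
    using dd that unfolding eq by auto
  ultimately have "\<psi>' (1/2) * (y - 1/2) \<le> \<psi> y - \<psi> (1/2)" if "y \<in> {0..1}" for y
    using f''_imp_f'[of "{0..1}" \<psi> \<psi>' "\<lambda>e. deriv (deriv \<phi>) e - c" "1/2" y] that by auto
  from this[of 0] this[of 1] have "2 * \<psi> (1/2) \<le> \<psi> 0 + \<psi> 1"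
    by auto
  moreover have "\<phi> 0 = L p0" "\<phi> 1 = L p1" "\<phi> (1/2) = L ((1/2) *\<^sub>R (p0 + p1))"
  proof -
    have "p0 + (1/2) *\<^sub>R w = (1/2) *\<^sub>R (p0 + p1)"
    proof -
      have "p0 + (1/2) *\<^sub>R w = (1/2 + 1/2) *\<^sub>R p0 + (1/2) *\<^sub>R (p1 - p0)" by (simp add: w_def)
      also have "\<dots> = (1/2) *\<^sub>R (p0 + p1)"
        unfolding scaleR_add_left scaleR_diff_right scaleR_add_right by simp
      finally show ?thesis .
    qed
    then show "\<phi> (1/2) = L ((1/2) *\<^sub>R (p0 + p1))" by (simp add: \<phi>_def)
  qed (auto simp: \<phi>_def w_def)
  ultimately show ?thesis
    by (simp add: \<psi>_def power2_eq_square field_simps)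
qed

lemma GDERIV_grad:
  fixes f :: "'a::euclidean_space \<Rightarrow> real"
  assumes "f differentiable (at x)"
  shows "GDERIV f x :> grad f x"
    and "grad f x = (\<Sum>b\<in>Basis. dir_deriv b f x *\<^sub>R b)"
proof -
  define D where "D = (\<Sum>b\<in>Basis. dir_deriv b f x *\<^sub>R b)"
  have "(f has_derivative frechet_derivative f (at x)) (at x)"
    using assms frechet_derivative_works by blast
  moreover have "frechet_derivative f (at x) = (\<lambda>h. h \<bullet> D)"
    using frechet_derivative_Basis_sum[OF assms]
    by (auto simp: D_def inner_sum_right mult.commute)
  ultimately have D: "GDERIV f x :> D" by (simp add: gderiv_def)
  \<comment> \<open>\<open>grad\<close> is a definite description, so it denotes the gradient only
    after uniqueness is shown.\<close>
  have "D' = D" if "GDERIV f x :> D'" for D'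
  proof -
    have "(\<lambda>h. h \<bullet> D') = (\<lambda>h. h \<bullet> D)"
      using that D unfolding gderiv_def by (rule has_derivative_unique)
    then have "(D' - D) \<bullet> D' = (D' - D) \<bullet> D" by meson
    then have "(D' - D) \<bullet> (D' - D) = 0" by (simp add: inner_diff_right)
    then show ?thesis by simp
  qed
  with D have "grad f x = D" unfolding grad_def by blast
  with D show "GDERIV f x :> grad f x" "grad f x = (\<Sum>b\<in>Basis. dir_deriv b f x *\<^sub>R b)"
    by (auto simp: D_def)
qed

lemma bounded_gradient_imp_Lipschitz:
  fixes f :: "'a::euclidean_space \<Rightarrow> real"
  assumes "\<And>x. GDERIV f x :> g x" and "\<And>x. norm (g x) \<le> B"
  shows "\<bar>f x - f y\<bar> \<le> B * norm (x - y)"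
proof -
  have "norm (f x - f y) \<le> B * norm (x - y)"
  proof (rule differentiable_bound)
    show "(f has_derivative (\<lambda>h. h \<bullet> g x)) (at x within UNIV)" for x
      using assms(1) by (simp add: gderiv_def)
    show "onorm (\<lambda>h. h \<bullet> g x) \<le> B" for x
    proof (rule onorm_le)
      show "norm (h \<bullet> g x) \<le> B * norm h" for h
        using Cauchy_Schwarz_ineq2[of h "g x"] mult_right_mono[OF assms(2)[of x], of "norm h"]
        by (simp add: mult.commute)
    qed
  qed auto
  then show ?thesis by simp
qed

text \<open>For fixed \<open>x1\<close> and \<open>x2\<close> the function
  \<open>f (y - x1) - f (y - x2)\<close> of \<open>y\<close> has gradient at most
  \<open>M * norm (x1 - x2)\<close>, hence is Lipschitz with that constant. This is the quantity
  that survives when two players facing different crowds are compared.\<close>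

lemma second_difference_bound:
  fixes f :: "'a::euclidean_space \<Rightarrow> real"
  assumes g: "\<And>x. GDERIV f x :> g x" and lip: "\<And>x y. norm (g x - g y) \<le> M * norm (x - y)"
  shows "\<bar>f (y2 - x1) - f (y2 - x2) - (f (y1 - x1) - f (y1 - x2))\<bar>
           \<le> M * norm (y1 - y2) * norm (x1 - x2)"
proof -
  have sh: "GDERIV (\<lambda>z. f (z - x)) y :> g (y - x)" for x y
  proof -
    have "(f has_derivative (\<lambda>h. h \<bullet> g (y - x))) (at (y - x))"
      using g by (simp add: gderiv_def)
    moreover have "((\<lambda>z. z - x) has_derivative (\<lambda>h. h)) (at y)"
      by (auto intro!: derivative_eq_intros)
    ultimately show ?thesis
      unfolding gderiv_def using has_derivative_compose by fastforce
  qed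
  have "\<bar>(f (y2 - x1) - f (y2 - x2)) - (f (y1 - x1) - f (y1 - x2))\<bar>
      \<le> (M * norm (x1 - x2)) * norm (y2 - y1)"
  proof (rule bounded_gradient_imp_Lipschitz[where g = "\<lambda>y. g (y - x1) - g (y - x2)"])
    show "GDERIV (\<lambda>z. f (z - x1) - f (z - x2)) y :> g (y - x1) - g (y - x2)" for y
      by (intro GDERIV_diff sh)
    show "norm (g (y - x1) - g (y - x2)) \<le> M * norm (x1 - x2)" for y
      using lip[of "y - x1" "y - x2"] by (simp add: norm_minus_commute)
  qed
  then show ?thesis
    by (simp add: norm_minus_commute mult.commute mult.left_commute)
qed

lemma bounded_derivs_imp_Lipschitz:
  fixes f :: "'a::euclidean_space \<Rightarrow> real"
  assumes C: "Ck (Suc k) f" and b: "bounded_derivs_upto n f" "1 \<le> n"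
  shows "\<exists>l\<ge>0. \<forall>x y. \<bar>f x - f y\<bar> \<le> l * norm (x - y)"
proof -
  have "bounded (range (dir_deriv b f))" if "b \<in> Basis" for b
    using b that unfolding bounded_derivs_upto_def
    by (auto dest!: spec[of _ "[b]"])
  then have "\<forall>b\<in>Basis. \<exists>B. \<forall>x. \<bar>dir_deriv b f x\<bar> \<le> B"
    by (auto simp: bounded_iff)
  then obtain B where B: "\<And>b x. b \<in> Basis \<Longrightarrow> \<bar>dir_deriv b f x\<bar> \<le> B b"
    by metis
  have df: "f differentiable (at x)" for x using C by auto
  have "norm (grad f x) \<le> sum B Basis" for x
    unfolding GDERIV_grad(2)[OF df] by (rule sum_norm_le) (auto simp: B)
  then have "\<bar>f x - f y\<bar> \<le> sum B Basis * norm (x - y)" for x y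
    using bounded_gradient_imp_Lipschitz[of f "grad f" "sum B Basis"] GDERIV_grad(1)[OF df] by auto
  moreover have "0 \<le> sum B Basis"
    by (rule sum_nonneg) (metis B abs_ge_zero order_trans)
  ultimately show ?thesis by blast
qed

lemma hess_formula:
  fixes f :: "'a::euclidean_space \<Rightarrow> real"
  assumes C: "Ck (Suc (Suc k)) f"
  shows "(grad f has_derivative hess f x) (at x)"
    and "hess f x v = (\<Sum>b\<in>Basis. (\<Sum>c\<in>Basis. (v \<bullet> c) * dir_deriv c (dir_deriv b f) x) *\<^sub>R b)"
proof -
  have df: "f differentiable (at x)" and df2: "b \<in> Basis \<Longrightarrow> dir_deriv b f differentiable (at x)" for x b
    using C by auto
  have "grad f = (\<lambda>x. \<Sum>b\<in>Basis. dir_deriv b f x *\<^sub>R b)"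
    using GDERIV_grad(2)[OF df] by auto
  moreover have "((\<lambda>x. \<Sum>b\<in>Basis. dir_deriv b f x *\<^sub>R b) has_derivative
      (\<lambda>h. \<Sum>b\<in>Basis. frechet_derivative (dir_deriv b f) (at x) h *\<^sub>R b)) (at x)"
    using df2 frechet_derivative_works
    by (intro has_derivative_sum has_derivative_scaleR_left) blast
  ultimately have d: "(grad f has_derivative
      (\<lambda>h. \<Sum>b\<in>Basis. frechet_derivative (dir_deriv b f) (at x) h *\<^sub>R b)) (at x)" by simp
  then have eq: "hess f x = (\<lambda>h. \<Sum>b\<in>Basis. frechet_derivative (dir_deriv b f) (at x) h *\<^sub>R b)"
    unfolding hess_def by (rule frechet_derivative_at[symmetric])
  with d show "(grad f has_derivative hess f x) (at x)" by simp
  show "hess f x v = (\<Sum>b\<in>Basis. (\<Sum>c\<in>Basis. (v \<bullet> c) * dir_deriv c (dir_deriv b f) x) *\<^sub>R b)"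
    unfolding eq using frechet_derivative_Basis_sum[OF df2] by auto
qed

text \<open>The essential supremum bounds the Hessian only almost everywhere. Since the second
  derivatives are continuous, the points satisfying the bound for a fixed vector \<open>v\<close>
  form a closed set of full measure, which is the whole space.\<close>

lemma hess_Linfty_Lipschitz_grad:
  fixes f :: "'a::euclidean_space \<Rightarrow> real"
  assumes C: "Ck (Suc (Suc (Suc k))) f" and M: "hess_Linfty f \<le> ereal M"
  shows "norm (grad f x - grad f y) \<le> M * norm (x - y)"
proof -
  have bl: "bounded_linear (hess f x)" for x
    using hess_formula(1)[OF C] has_derivative_bounded_linear by blast
  have "AE x in lborel. onorm (hess f x) \<le> M"
  proof -
    have "AE x in lborel. ereal (onorm (hess f x)) \<le> hess_Linfty f"
      unfolding hess_Linfty_def by (rule esssup_AE)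
    then show ?thesis
    proof eventually_elim
      case (elim x)
      then have "ereal (onorm (hess f x)) \<le> ereal M" using M by (rule order_trans)
      then show ?case by simp
    qed
  qed
  then have ae: "AE x in lebesgue. onorm (hess f x) \<le> M"
    by (rule AE_completion)
  have cont: "continuous_on UNIV (\<lambda>x. hess f x v)" for v
  proof -
    have "continuous_on UNIV (dir_deriv c (dir_deriv b f))" if "b \<in> Basis" "c \<in> Basis" for b c
      using C that by (intro Ck_Suc_continuous[where k = k]) auto
    then show ?thesis
      unfolding hess_formula(2)[OF C] by (intro continuous_intros)
  qed
  have le: "norm (hess f x v) \<le> M * norm v" for x v
  proof -
    have "closed {x. norm (hess f x v) \<le> M * norm v}"
      by (intro closed_Collect_le continuous_intros cont)
    moreover have "AE x in lebesgue. x \<in> {x. norm (hess f x v) \<le> M * norm v}"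
      using ae
    proof eventually_elim
      case (elim x)
      have "norm (hess f x v) \<le> onorm (hess f x) * norm v"
        by (rule onorm[OF bl])
      also have "\<dots> \<le> M * norm v" using elim by (simp add: mult_right_mono)
      finally show ?case by simp
    qed
    ultimately show ?thesis using mem_closed_if_AE_lebesgue by blast
  qed
  show ?thesis
  proof (rule differentiable_bound)
    show "(grad f has_derivative hess f x) (at x within UNIV)" for x
      using hess_formula(1)[OF C] by simp
    show "onorm (hess f x) \<le> M" for x
      by (rule onorm_le) (rule le)
  qed auto
qed

text \<open>An assertion independent of \<open>x\<close> that holds almost everywhere holds, since
  Lebesgue measure does not vanish. The sign is needed to turn the smallness condition, stated in
  the extended reals, into one between real numbers.\<close>

lemma hess_Linfty_nonneg:
  fixes f :: "'a::euclidean_space \<Rightarrow> real"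
  assumes C: "Ck (Suc (Suc (Suc k))) f"
  shows "0 \<le> hess_Linfty f"
proof -
  have bl: "bounded_linear (hess f x)" for x
    using hess_formula(1)[OF C] has_derivative_bounded_linear by blast
  have "AE x in lborel. ereal (onorm (hess f x)) \<le> hess_Linfty f"
    unfolding hess_Linfty_def by (rule esssup_AE)
  then have "AE x in (lborel::'a measure). 0 \<le> hess_Linfty f"
    by eventually_elim (meson bl onorm_pos_le ereal_less_eq(5) order_trans)
  then have "AE x in (lebesgue::'a measure). x \<in> {x. 0 \<le> hess_Linfty f}"
    by (auto dest: AE_completion)
  moreover have "closed {x::'a. 0 \<le> hess_Linfty f}" by simp
  ultimately have "(0::'a) \<in> {x. 0 \<le> hess_Linfty f}"
    using mem_closed_if_AE_lebesgue by blast
  then show ?thesis by (simp split: if_splits)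
qed

subsection \<open>The problem of a single player\<close>

definition state_path :: "real \<Rightarrow> 'a::euclidean_space \<Rightarrow> (real \<Rightarrow> 'a) \<Rightarrow> real \<Rightarrow> 'a" where
  "state_path T q A t = q - (LINT s:{t..T}|lebesgue. A s)"

lemma set_integrable_iff_lebesgue_on:
  fixes f :: "'b::euclidean_space \<Rightarrow> 'a::{banach, second_countable_topology}"
  assumes "S \<in> sets lebesgue"
  shows "set_integrable lebesgue S f \<longleftrightarrow> integrable (lebesgue_on S) f"
  unfolding set_integrable_def using assms by (subst integrable_restrict_space) auto

lemma set_integral_eq_lebesgue_on:
  fixes f :: "'b::euclidean_space \<Rightarrow> 'a::{banach, second_countable_topology}"
  assumes "S \<in> sets lebesgue"
  shows "(LINT x:S|lebesgue. f x) = (\<integral>x. f x \<partial>lebesgue_on S)"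
  unfolding set_lebesgue_integral_def using assms by (subst integral_restrict_space) auto

text \<open>With an indicator, all paths become integrals over the same measure space, where
  linearity handles their sums and differences. The condition \<open>0 \<le> t\<close> keeps
  \<open>{t..T}\<close> inside \<open>{0..T}\<close>.\<close>

lemma state_path_eq:
  assumes "0 \<le> t"
  shows "state_path T q A t = q - (\<integral>s. indicator {t..T} s *\<^sub>R A s \<partial>lebesgue_on {0..T})"
proof -
  have "(\<integral>s. indicator {t..T} s *\<^sub>R A s \<partial>lebesgue_on {0..T})
      = (\<integral>s. indicator {0..T} s *\<^sub>R indicator {t..T} s *\<^sub>R A s \<partial>lebesgue)"
    by (rule integral_restrict_space) simp
  also have "\<dots> = (LINT s:{t..T}|lebesgue. A s)"
    unfolding set_lebesgue_integral_def using assms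
    by (intro Bochner_Integration.integral_cong) (auto simp: indicator_def)
  finally show ?thesis by (simp add: state_path_def)
qed

lemma integrable_indicator_ivl:
  fixes A :: "real \<Rightarrow> 'a::euclidean_space"
  assumes "integrable (lebesgue_on {0..T}) A"
  shows "integrable (lebesgue_on {0..T}) (\<lambda>s. indicator {t..T} s *\<^sub>R A s)"
proof (rule Bochner_Integration.integrable_bound[OF assms])
  have "indicat_real {t..T} \<in> borel_measurable lebesgue" by (intro borel_measurable_indicator) simp
  then have "indicat_real {t..T} \<in> borel_measurable (lebesgue_on {0..T})"
    by (rule measurable_restrict_space1)
  then show "(\<lambda>s. indicator {t..T} s *\<^sub>R A s) \<in> borel_measurable (lebesgue_on {0..T})"
    using assms by auto
qed (auto simp: indicator_def)

lemma state_path_diff: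
  assumes "integrable (lebesgue_on {0..T}) A" "integrable (lebesgue_on {0..T}) B" "0 \<le> t"
  shows "norm (state_path T q A t - state_path T q' B t)
    \<le> norm (q - q') + (\<integral>s. norm (A s - B s) \<partial>lebesgue_on {0..T})"
proof -
  let ?M = "lebesgue_on {0..T}"
  have "state_path T q A t - state_path T q' B t
      = (q - q') - (\<integral>s. indicator {t..T} s *\<^sub>R (A s - B s) \<partial>?M)"
    using assms integrable_indicator_ivl[of T A t] integrable_indicator_ivl[of T B t]
    by (simp add: state_path_eq scaleR_diff_right)
  moreover have "norm (\<integral>s. indicator {t..T} s *\<^sub>R (A s - B s) \<partial>?M)
      \<le> (\<integral>s. norm (A s - B s) \<partial>?M)"
    using assms integrable_indicator_ivl[of T "\<lambda>s. A s - B s" t]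
    by (intro Bochner_Integration.integral_norm_bound_integral) (auto simp: indicator_def)
  ultimately show ?thesis
    by (smt (verit) norm_triangle_ineq4)
qed

lemma state_path_midpoint:
  assumes "integrable (lebesgue_on {0..T}) A" "integrable (lebesgue_on {0..T}) B" "0 \<le> t"
  shows "state_path T q (\<lambda>s. (1/2) *\<^sub>R (A s + B s)) t
    = (1/2) *\<^sub>R (state_path T q A t + state_path T q B t)"
proof -
  have "(\<integral>s. indicator {t..T} s *\<^sub>R ((1/2) *\<^sub>R (A s + B s)) \<partial>lebesgue_on {0..T})
      = (\<integral>s. (1/2) *\<^sub>R (indicator {t..T} s *\<^sub>R A s + indicator {t..T} s *\<^sub>R B s) \<partial>lebesgue_on {0..T})"
    by (intro Bochner_Integration.integral_cong) (auto simp: algebra_simps)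
  also have "\<dots> = (1/2) *\<^sub>R ((\<integral>s. indicator {t..T} s *\<^sub>R A s \<partial>lebesgue_on {0..T})
      + (\<integral>s. indicator {t..T} s *\<^sub>R B s \<partial>lebesgue_on {0..T}))"
    using integrable_indicator_ivl[OF assms(1), of t] integrable_indicator_ivl[OF assms(2), of t]
    by simp
  finally have *: "(\<integral>s. indicator {t..T} s *\<^sub>R ((1/2) *\<^sub>R (A s + B s)) \<partial>lebesgue_on {0..T}) = \<dots>" .
  have "q = (1/2 + 1/2) *\<^sub>R q" by simp
  then have "q = (1/2) *\<^sub>R (q + q)" unfolding scaleR_add_left scaleR_add_right .
  then have "q - (1/2) *\<^sub>R (a + b) = (1/2) *\<^sub>R ((q - a) + (q - b))" for a b
    by (simp add: algebra_simps)
  then show ?thesis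
    unfolding state_path_eq[OF assms(3)] * by metis
qed

lemma continuous_on_state_path:
  assumes "integrable (lebesgue_on {0..T}) A"
  shows "continuous_on {0..T} (state_path T q A)"
proof -
  have "A integrable_on {0..T}"
    using assms by (intro integrable_on_lebesgue_on) auto
  then have "continuous_on {0..T} (\<lambda>t. q - integral {t..T} A)"
    by (intro continuous_intros indefinite_integral_continuous_1')
  moreover have "state_path T q A t = q - integral {t..T} A" if "t \<in> {0..T}" for t
  proof -
    have "integrable (lebesgue_on {t..T}) A"
      using integrable_subinterval[OF assms] that by auto
    then show ?thesis
      by (simp add: state_path_def set_integral_eq_lebesgue_on lebesgue_integral_eq_integral)
  qed
  ultimately show ?thesis by (auto intro: continuous_on_eq)
qed

lemma state_path_cong_AE:
  assumes "AE s in lebesgue_on {0..T}. A s = B s" "0 \<le> t"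
    "integrable (lebesgue_on {0..T}) A" "integrable (lebesgue_on {0..T}) B"
  shows "state_path T q A t = state_path T q B t"
proof -
  have "(\<integral>s. norm (A s - B s) \<partial>lebesgue_on {0..T}) = 0"
    by (rule integral_eq_zero_AE) (use assms(1) in eventually_elim, auto)
  then show ?thesis
    using state_path_diff[OF assms(3,4,2), of q q] by simp
qed

lemma measure_lebesgue_on_space: "0 \<le> T \<Longrightarrow> measure (lebesgue_on {0..T::real}) {0..T} = T"
  by (simp add: measure_restrict_space)

lemma state_path_diff_square:
  assumes "0 \<le> T" "integrable (lebesgue_on {0..T}) A" "integrable (lebesgue_on {0..T}) B" "0 \<le> t"
    and "integrable (lebesgue_on {0..T}) (\<lambda>s. (norm (A s - B s))\<^sup>2)"
  shows "(norm (state_path T q A t - state_path T q B t))\<^sup>2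
    \<le> T * (\<integral>s. (norm (A s - B s))\<^sup>2 \<partial>lebesgue_on {0..T})"
proof -
  interpret finite_measure "lebesgue_on {0..T}" by (rule finite_measure_lebesgue_on) simp
  have "(norm (state_path T q A t - state_path T q B t))\<^sup>2
      \<le> (\<integral>s. norm (A s - B s) \<partial>lebesgue_on {0..T})\<^sup>2"
    using state_path_diff[OF assms(2-4), of q q] by (intro power_mono) auto
  also have "\<dots> \<le> T * (\<integral>s. (norm (A s - B s))\<^sup>2 \<partial>lebesgue_on {0..T})"
    using integral_norm_square_le[of "\<lambda>s. A s - B s"] assms measure_lebesgue_on_space[of T] by simp
  finally show ?thesis .
qed

text \<open>The standing assumptions in integrated form: derivative bounds appear as Lipschitz and
  second-difference estimates, and strong convexity as a midpoint inequality. \<open>MP\<close> and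
  \<open>MQ\<close> stand for the Hessian norms of \<open>\<Phi>\<close> and \<open>\<Psi>\<close>,
  \<open>l\<close> and \<open>m\<close> for a common Lipschitz constant and a common lower bound of
  the two potentials.\<close>

locale mfg =
  fixes L :: "'a::euclidean_space \<times> 'a \<Rightarrow> real" and \<Phi> \<Psi> :: "'a \<Rightarrow> real"
    and c0 c1 lam l m MP MQ T :: real
  assumes L_cont: "continuous_on UNIV L"
    and c0_pos: "0 < c0" and L_coercive: "\<And>q v. c0 * (norm v)\<^sup>2 \<le> L (q, v)"
    and c1_nonneg: "0 \<le> c1" and L_lip: "\<And>q q' v. \<bar>L (q, v) - L (q', v)\<bar> \<le> c1 * norm (q - q')"
    and lam_pos: "0 < lam"
    and L_mid: "\<And>q0 q1 v0 v1. L ((1/2) *\<^sub>R (q0 + q1), (1/2) *\<^sub>R (v0 + v1))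
      \<le> (L (q0, v0) + L (q1, v1)) / 2 - lam / 8 * (norm (v0 - v1))\<^sup>2"
    and l_nonneg: "0 \<le> l"
    and \<Phi>_lip: "\<And>x y. \<bar>\<Phi> x - \<Phi> y\<bar> \<le> l * norm (x - y)"
    and \<Psi>_lip: "\<And>x y. \<bar>\<Psi> x - \<Psi> y\<bar> \<le> l * norm (x - y)"
    and \<Phi>_ge: "\<And>x. m \<le> \<Phi> x" and \<Psi>_ge: "\<And>x. m \<le> \<Psi> x"
    and MP_nonneg: "0 \<le> MP" and MQ_nonneg: "0 \<le> MQ"
    and \<Phi>_diff2: "\<And>x1 x2 y1 y2. \<bar>\<Phi> (y2 - x1) - \<Phi> (y2 - x2) - (\<Phi> (y1 - x1) - \<Phi> (y1 - x2))\<bar>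
      \<le> MP * norm (y1 - y2) * norm (x1 - x2)"
    and \<Psi>_diff2: "\<And>x1 x2 y1 y2. \<bar>\<Psi> (y2 - x1) - \<Psi> (y2 - x2) - (\<Psi> (y1 - x1) - \<Psi> (y1 - x2))\<bar>
      \<le> MQ * norm (y1 - y2) * norm (x1 - x2)"
    and T_pos: "0 < T"
    and small: "T\<^sup>2 * MP + T * MQ \<le> lam / 4"
begin

abbreviation "tm \<equiv> lebesgue_on {0..T}"
abbreviation "pm \<equiv> lebesgue_on players"

text \<open>Freezing the state at 0 makes the notion independent of the terminal position. As
  \<open>L\<close> is Lipschitz in the state, the running cost of an integrable control is finite
  along one continuous path if and only if it is finite along all of them.\<close>

definition admissible :: "(real \<Rightarrow> 'a) \<Rightarrow> bool" where
  "admissible A \<longleftrightarrow> integrable tm A \<and> integrable tm (\<lambda>t. L (0, A t))"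

text \<open>Wide enough for bounded continuous functions of \<open>(t, \<omega>)\<close> and for the
  trajectories of every collective control. The integrable bound common to all \<open>t\<close>
  permits dominated convergence when \<open>t\<close> varies.\<close>

definition flow :: "(real \<Rightarrow> real \<Rightarrow> 'a) \<Rightarrow> bool" where
  "flow X \<longleftrightarrow> (\<forall>t\<in>{0..T}. X t \<in> borel_measurable pm) \<and>
     (\<forall>\<omega>\<in>players. continuous_on {0..T} (\<lambda>t. X t \<omega>)) \<and>
     (\<exists>h. integrable pm h \<and> (\<forall>t\<in>{0..T}. \<forall>\<omega>\<in>players. norm (X t \<omega>) \<le> h \<omega>))"

definition running :: "(real \<Rightarrow> real \<Rightarrow> 'a) \<Rightarrow> real \<Rightarrow> 'a \<Rightarrow> real" where
  "running X t x = (\<integral>\<omega>. \<Phi> (x - X t \<omega>) \<partial>pm)"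

definition initial :: "(real \<Rightarrow> real \<Rightarrow> 'a) \<Rightarrow> 'a \<Rightarrow> real" where
  "initial X x = (\<integral>\<omega>. \<Psi> (x - X 0 \<omega>) \<partial>pm)"

definition J :: "(real \<Rightarrow> real \<Rightarrow> 'a) \<Rightarrow> 'a \<Rightarrow> (real \<Rightarrow> 'a) \<Rightarrow> real" where
  "J X q A = (\<integral>t. L (state_path T q A t, A t) \<partial>tm)
     + (\<integral>t. running X t (state_path T q A t) \<partial>tm) + initial X (state_path T q A 0)"

definition optimal :: "(real \<Rightarrow> real \<Rightarrow> 'a) \<Rightarrow> 'a \<Rightarrow> (real \<Rightarrow> 'a) \<Rightarrow> bool" where
  "optimal X q A \<longleftrightarrow> admissible A \<and> (\<forall>B. admissible B \<longrightarrow> J X q A \<le> J X q B)"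

definition energy :: "(real \<Rightarrow> 'a) \<Rightarrow> (real \<Rightarrow> 'a) \<Rightarrow> real" where
  "energy A B = (\<integral>t. (norm (A t - B t))\<^sup>2 \<partial>tm)"

lemma energy_nonneg: "0 \<le> energy A B"
  by (simp add: energy_def)

lemma energy_commute: "energy A B = energy B A"
  by (simp add: energy_def norm_minus_commute)

lemma L_nonneg: "0 \<le> L p"
proof -
  have "0 \<le> c0 * (norm (snd p))\<^sup>2" using c0_pos by simp
  also have "\<dots> \<le> L p" using L_coercive[of "snd p" "fst p"] by simp
  finally show ?thesis .
qed

lemma L_measurable[measurable]: "L \<in> borel_measurable borel"
  using L_cont by (rule borel_measurable_continuous_onI)

lemma \<Phi>_continuous: "continuous_on UNIV \<Phi>" and \<Psi>_continuous: "continuous_on UNIV \<Psi>"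
proof -
  have "l-lipschitz_on UNIV \<Phi>" "l-lipschitz_on UNIV \<Psi>"
    using \<Phi>_lip \<Psi>_lip l_nonneg by (auto intro!: lipschitz_onI simp: dist_norm)
  then show "continuous_on UNIV \<Phi>" "continuous_on UNIV \<Psi>"
    by (auto intro: lipschitz_on_continuous_on)
qed

lemma \<Phi>_measurable[measurable]: "\<Phi> \<in> borel_measurable borel"
  and \<Psi>_measurable[measurable]: "\<Psi> \<in> borel_measurable borel"
  using \<Phi>_continuous \<Psi>_continuous by (auto intro: borel_measurable_continuous_onI)

lemma finite_tm: "finite_measure tm"
  by (rule finite_measure_lebesgue_on) simp

lemma measure_tm: "measure tm {0..T} = T"
  using T_pos by (simp add: measure_lebesgue_on_space)

lemma finite_pm: "finite_measure pm"
  by (rule finite_measure_lebesgue_on) simp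

lemma measure_pm: "measure pm players = 1"
  by (simp add: measure_restrict_space)

section \<open>Running cost along paths and admissible controls\<close>

lemma L_path_measurable:
  assumes "A \<in> borel_measurable tm" "continuous_on {0..T} y"
  shows "(\<lambda>t. L (y t, A t)) \<in> borel_measurable tm"
proof -
  have "y \<in> borel_measurable tm"
    using assms(2) by (intro continuous_imp_measurable_on_sets_lebesgue) auto
  then have "(\<lambda>t. (y t, A t)) \<in> borel_measurable tm" using assms(1) by (rule borel_measurable_Pair)
  then show ?thesis by (rule measurable_compose[OF _ L_measurable])
qed

lemma L_path_integrable_transfer:
  assumes A: "integrable tm A" and y: "continuous_on {0..T} y" "continuous_on {0..T} z"
    and i: "integrable tm (\<lambda>t. L (y t, A t))"
  shows "integrable tm (\<lambda>t. L (z t, A t))"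
proof (rule Bochner_Integration.integrable_bound)
  show "integrable tm (\<lambda>t. L (y t, A t) + c1 * norm (z t - y t))"
    by (intro Bochner_Integration.integrable_add i continuous_imp_integrable_real continuous_intros y)
  show "(\<lambda>t. L (z t, A t)) \<in> borel_measurable tm"
    using A y by (intro L_path_measurable) auto
  have "norm (L (z t, A t)) \<le> norm (L (y t, A t) + c1 * norm (z t - y t))" for t
    using L_lip[of "z t" "A t" "y t"] L_nonneg[of "(z t, A t)"] by auto
  then show "AE t in tm. norm (L (z t, A t)) \<le> norm (L (y t, A t) + c1 * norm (z t - y t))"
    by simp
qed

lemma admissible_L_integrable:
  assumes "admissible A" "continuous_on {0..T} y"
  shows "integrable tm (\<lambda>t. L (y t, A t))"
  using assms L_path_integrable_transfer[of A "\<lambda>_. 0" y] by (auto simp: admissible_def)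

lemma admissible_path_integrable:
  "admissible A \<Longrightarrow> integrable tm (\<lambda>t. L (state_path T q A t, A t))"
  by (intro admissible_L_integrable continuous_on_state_path) (auto simp: admissible_def)

lemma admissible_square_integrable:
  assumes "admissible A"
  shows "integrable tm (\<lambda>t. (norm (A t))\<^sup>2)"
proof (rule Bochner_Integration.integrable_bound)
  show "integrable tm (\<lambda>t. L (0, A t) / c0)" using assms by (auto simp: admissible_def)
  have "norm ((norm (A t))\<^sup>2) \<le> norm (L (0, A t) / c0)" for t
    using L_coercive[of "A t" 0] c0_pos L_nonneg[of "(0, A t)"] by (simp add: field_simps)
  then show "AE t in tm. norm ((norm (A t))\<^sup>2) \<le> norm (L (0, A t) / c0)" by simp
qed (use assms in \<open>auto simp: admissible_def\<close>)

lemma admissible_diff_square_integrable: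
  assumes "admissible A" "admissible B"
  shows "integrable tm (\<lambda>t. (norm (A t - B t))\<^sup>2)"
proof (rule Bochner_Integration.integrable_bound)
  show "integrable tm (\<lambda>t. 2 * (norm (A t))\<^sup>2 + 2 * (norm (B t))\<^sup>2)"
    using assms[THEN admissible_square_integrable] by simp
  have "norm ((norm (A t - B t))\<^sup>2) \<le> norm (2 * (norm (A t))\<^sup>2 + 2 * (norm (B t))\<^sup>2)" for t
  proof -
    have "(norm (A t - B t))\<^sup>2 \<le> (norm (A t) + norm (B t))\<^sup>2"
      by (intro power_mono norm_triangle_ineq4) auto
    also have "\<dots> \<le> 2 * (norm (A t))\<^sup>2 + 2 * (norm (B t))\<^sup>2"
      using zero_le_power2[of "norm (A t) - norm (B t)"] by (simp add: power2_eq_square algebra_simps)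
    finally show ?thesis by simp
  qed
  then show "AE t in tm. norm ((norm (A t - B t))\<^sup>2) \<le> norm (2 * (norm (A t))\<^sup>2 + 2 * (norm (B t))\<^sup>2)"
    by simp
qed (use assms in \<open>auto simp: admissible_def\<close>)

lemma admissible_zero: "admissible (\<lambda>_. 0)"
  by (auto simp: admissible_def)

lemma path_diff_energy:
  assumes "admissible A" "admissible B" "0 \<le> t"
  shows "(norm (state_path T q A t - state_path T q B t))\<^sup>2 \<le> T * energy A B"
  unfolding energy_def
  using assms T_pos admissible_diff_square_integrable[OF assms(1,2)]
  by (intro state_path_diff_square) (auto simp: admissible_def)

text \<open>The mixed second difference with both increments equal to \<open>h\<close>, half of
  \<open>a - b\<close>, is the central second difference at the midpoint. Thus the constant that
  governs the interaction also bounds the convexity defect.\<close>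

lemma midpoint_bound_of_diff2:
  fixes f :: "'a \<Rightarrow> real"
  assumes "\<And>x1 x2 y1 y2. \<bar>f (y2 - x1) - f (y2 - x2) - (f (y1 - x1) - f (y1 - x2))\<bar>
      \<le> K * norm (y1 - y2) * norm (x1 - x2)"
  shows "f ((1/2) *\<^sub>R (a + b)) \<le> (f a + f b) / 2 + K / 8 * (norm (a - b))\<^sup>2"
proof -
  define h where "h = (1/2) *\<^sub>R (a - b)"
  have "a = (1/2 + 1/2) *\<^sub>R a" "b = (1/2 + 1/2) *\<^sub>R b" by simp_all
  then have ab: "a = (1/2) *\<^sub>R (a + b) + h" "b = (1/2) *\<^sub>R (a + b) - h"
    unfolding h_def scaleR_add_left scaleR_add_right scaleR_diff_right by auto
  define c where "c = (1/2) *\<^sub>R (a + b)"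
  have ca: "c + h = a" "c - h = b" using ab by (simp_all add: c_def)
  have nh: "norm (a - b) = 2 * norm h" by (simp add: h_def)
  have "\<bar>f (c + h - 0) - f (c + h - h) - (f (c - 0) - f (c - h))\<bar> \<le> K * norm (c - (c + h)) * norm (0 - h)"
    by (rule assms)
  then have "\<bar>f a - f c - (f c - f b)\<bar> \<le> K * norm h * norm h"
    by (simp flip: ca)
  then show ?thesis
    unfolding nh c_def[symmetric] by (simp add: power2_eq_square abs_le_iff field_simps)
qed

section \<open>Potentials averaged over the crowd\<close>

lemma flow_measurable: "flow X \<Longrightarrow> t \<in> {0..T} \<Longrightarrow> X t \<in> borel_measurable pm"
  by (simp add: flow_def)

lemma flow_integrable:
  assumes "flow X" "t \<in> {0..T}"
  shows "integrable pm (X t)"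
proof -
  obtain h where i: "integrable pm h" and b: "\<forall>\<omega>\<in>players. norm (X t \<omega>) \<le> h \<omega>"
    using assms by (auto simp: flow_def)
  have "AE \<omega> in pm. norm (X t \<omega>) \<le> norm (h \<omega>)"
  proof (rule AE_I2)
    fix \<omega> assume "\<omega> \<in> space pm"
    then have "norm (X t \<omega>) \<le> h \<omega>" using b by simp
    then show "norm (X t \<omega>) \<le> norm (h \<omega>)" by simp
  qed
  then show ?thesis
    by (rule Bochner_Integration.integrable_bound[OF i flow_measurable[OF assms]])
qed

lemma lipschitz_flow_integrable:
  fixes f :: "'a \<Rightarrow> real"
  assumes X: "flow X" "t \<in> {0..T}" and f: "\<And>x y. \<bar>f x - f y\<bar> \<le> l * norm (x - y)"
    and [measurable]: "f \<in> borel_measurable borel"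
  shows "integrable pm (\<lambda>\<omega>. f (x - X t \<omega>))"
proof (rule Bochner_Integration.integrable_bound)
  interpret finite_measure pm by (rule finite_pm)
  note flow_measurable[OF X, measurable]
  show "integrable pm (\<lambda>\<omega>. \<bar>f x\<bar> + l * norm (X t \<omega>))"
    using flow_integrable[OF X] by simp
  show "(\<lambda>\<omega>. f (x - X t \<omega>)) \<in> borel_measurable pm" by measurable
  have "norm (f (x - X t \<omega>)) \<le> norm (\<bar>f x\<bar> + l * norm (X t \<omega>))" for \<omega>
    using f[of "x - X t \<omega>" x] by simp
  then show "AE \<omega> in pm. norm (f (x - X t \<omega>)) \<le> norm (\<bar>f x\<bar> + l * norm (X t \<omega>))" by simp
qed

lemma \<Phi>_flow_integrable: "flow X \<Longrightarrow> t \<in> {0..T} \<Longrightarrow> integrable pm (\<lambda>\<omega>. \<Phi> (x - X t \<omega>))"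
  by (rule lipschitz_flow_integrable[OF _ _ \<Phi>_lip \<Phi>_measurable])

lemma \<Psi>_flow_integrable: "flow X \<Longrightarrow> t \<in> {0..T} \<Longrightarrow> integrable pm (\<lambda>\<omega>. \<Psi> (x - X t \<omega>))"
  by (rule lipschitz_flow_integrable[OF _ _ \<Psi>_lip \<Psi>_measurable])

lemma zero_in_time: "0 \<in> {0..T}"
  using T_pos by simp

lemma average_mono:
  fixes f g :: "real \<Rightarrow> real"
  shows "integrable pm f \<Longrightarrow> integrable pm g \<Longrightarrow> (\<And>\<omega>. f \<omega> \<le> g \<omega>) \<Longrightarrow> (\<integral>\<omega>. f \<omega> \<partial>pm) \<le> (\<integral>\<omega>. g \<omega> \<partial>pm)"
  by (rule integral_mono)

lemma average_Lipschitz: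
  fixes f :: "'a \<Rightarrow> real"
  assumes int: "\<And>x. integrable pm (\<lambda>\<omega>. f (x - Y \<omega>))" and f: "\<And>x y. \<bar>f x - f y\<bar> \<le> l * norm (x - y)"
  shows "\<bar>(\<integral>\<omega>. f (x - Y \<omega>) \<partial>pm) - (\<integral>\<omega>. f (y - Y \<omega>) \<partial>pm)\<bar> \<le> l * norm (x - y)"
proof -
  interpret finite_measure pm by (rule finite_pm)
  have "\<bar>(\<integral>\<omega>. f (x - Y \<omega>) - f (y - Y \<omega>) \<partial>pm)\<bar> \<le> (\<integral>\<omega>. l * norm (x - y) \<partial>pm)"
  proof (rule integral_abs_bound_integral)
    show "\<bar>f (x - Y \<omega>) - f (y - Y \<omega>)\<bar> \<le> l * norm (x - y)" for \<omega>
      using f[of "x - Y \<omega>" "y - Y \<omega>"] by simp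
  qed (use int in auto)
  then show ?thesis using int by (simp add: measure_pm)
qed

lemma average_midpoint:
  fixes f :: "'a \<Rightarrow> real"
  assumes int: "\<And>x. integrable pm (\<lambda>\<omega>. f (x - Y \<omega>))"
    and f: "\<And>a b. f ((1/2) *\<^sub>R (a + b)) \<le> (f a + f b) / 2 + K / 8 * (norm (a - b))\<^sup>2"
  shows "(\<integral>\<omega>. f ((1/2) *\<^sub>R (a + b) - Y \<omega>) \<partial>pm)
    \<le> ((\<integral>\<omega>. f (a - Y \<omega>) \<partial>pm) + (\<integral>\<omega>. f (b - Y \<omega>) \<partial>pm)) / 2 + K / 8 * (norm (a - b))\<^sup>2"
proof -
  interpret finite_measure pm by (rule finite_pm)
  have "(\<integral>\<omega>. f ((1/2) *\<^sub>R (a + b) - Y \<omega>) \<partial>pm)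
      \<le> (\<integral>\<omega>. (f (a - Y \<omega>) + f (b - Y \<omega>)) / 2 + K / 8 * (norm (a - b))\<^sup>2 \<partial>pm)"
  proof (rule average_mono)
    fix \<omega>
    have "Y \<omega> = (1/2 + 1/2) *\<^sub>R Y \<omega>" by simp
    then have "Y \<omega> = (1/2) *\<^sub>R (Y \<omega> + Y \<omega>)" unfolding scaleR_add_left scaleR_add_right .
    then have "(1/2) *\<^sub>R (a + b) - Y \<omega> = (1/2) *\<^sub>R ((a - Y \<omega>) + (b - Y \<omega>))"
      by (simp add: algebra_simps)
    then show "f ((1/2) *\<^sub>R (a + b) - Y \<omega>)
        \<le> (f (a - Y \<omega>) + f (b - Y \<omega>)) / 2 + K / 8 * (norm (a - b))\<^sup>2"
      using f[of "a - Y \<omega>" "b - Y \<omega>"] by simp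
  qed (use int in auto)
  then show ?thesis using int by (simp add: measure_pm)
qed

lemma average_diff2:
  fixes f :: "'a \<Rightarrow> real"
  assumes int: "\<And>x. integrable pm (\<lambda>\<omega>. f (x - Y \<omega>))" "\<And>x. integrable pm (\<lambda>\<omega>. f (x - Z \<omega>))"
    and YZ: "integrable pm Y" "integrable pm Z"
    and f: "\<And>x1 x2 y1 y2. \<bar>f (y2 - x1) - f (y2 - x2) - (f (y1 - x1) - f (y1 - x2))\<bar>
      \<le> K * norm (y1 - y2) * norm (x1 - x2)"
  shows "\<bar>(\<integral>\<omega>. f (b - Y \<omega>) \<partial>pm) - (\<integral>\<omega>. f (b - Z \<omega>) \<partial>pm)
      - ((\<integral>\<omega>. f (a - Y \<omega>) \<partial>pm) - (\<integral>\<omega>. f (a - Z \<omega>) \<partial>pm))\<bar>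
    \<le> K * norm (a - b) * (\<integral>\<omega>. norm (Y \<omega> - Z \<omega>) \<partial>pm)"
proof -
  have "\<bar>(\<integral>\<omega>. f (b - Y \<omega>) - f (b - Z \<omega>) - (f (a - Y \<omega>) - f (a - Z \<omega>)) \<partial>pm)\<bar>
      \<le> (\<integral>\<omega>. K * norm (a - b) * norm (Y \<omega> - Z \<omega>) \<partial>pm)"
    using int YZ f by (intro integral_abs_bound_integral) auto
  then show ?thesis using int YZ by simp
qed

lemma running_Lipschitz:
  "flow X \<Longrightarrow> t \<in> {0..T} \<Longrightarrow> \<bar>running X t x - running X t y\<bar> \<le> l * norm (x - y)"
  unfolding running_def by (rule average_Lipschitz[OF \<Phi>_flow_integrable \<Phi>_lip])

lemma initial_Lipschitz:
  "flow X \<Longrightarrow> \<bar>initial X x - initial X y\<bar> \<le> l * norm (x - y)"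
  unfolding initial_def by (rule average_Lipschitz[OF \<Psi>_flow_integrable[OF _ zero_in_time] \<Psi>_lip])

lemma running_ge: "flow X \<Longrightarrow> t \<in> {0..T} \<Longrightarrow> m \<le> running X t x"
proof -
  assume X: "flow X" "t \<in> {0..T}"
  interpret finite_measure pm by (rule finite_pm)
  have "(\<integral>\<omega>. m \<partial>pm) \<le> running X t x"
    unfolding running_def by (intro average_mono \<Phi>_flow_integrable X \<Phi>_ge) simp
  then show ?thesis by (simp add: measure_pm)
qed

lemma initial_ge: "flow X \<Longrightarrow> m \<le> initial X x"
proof -
  assume X: "flow X"
  interpret finite_measure pm by (rule finite_pm)
  have "(\<integral>\<omega>. m \<partial>pm) \<le> initial X x"
    unfolding initial_def using zero_in_time by (intro average_mono \<Psi>_flow_integrable X \<Psi>_ge) simp_all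
  then show ?thesis by (simp add: measure_pm)
qed

lemma running_midpoint:
  assumes "flow X" "t \<in> {0..T}"
  shows "running X t ((1/2) *\<^sub>R (a + b)) \<le> (running X t a + running X t b) / 2 + MP / 8 * (norm (a - b))\<^sup>2"
  unfolding running_def
  by (rule average_midpoint[OF \<Phi>_flow_integrable[OF assms] midpoint_bound_of_diff2[OF \<Phi>_diff2]])

lemma initial_midpoint:
  assumes "flow X"
  shows "initial X ((1/2) *\<^sub>R (a + b)) \<le> (initial X a + initial X b) / 2 + MQ / 8 * (norm (a - b))\<^sup>2"
  unfolding initial_def
  by (rule average_midpoint[OF \<Psi>_flow_integrable[OF assms zero_in_time] midpoint_bound_of_diff2[OF \<Psi>_diff2]])

lemma running_continuous:
  assumes X: "flow X"
  shows "continuous_on {0..T} (\<lambda>t. running X t x)"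
proof -
  obtain h where h: "integrable pm h" "\<And>t \<omega>. t \<in> {0..T} \<Longrightarrow> \<omega> \<in> players \<Longrightarrow> norm (X t \<omega>) \<le> h \<omega>"
    using X by (auto simp: flow_def)
  show ?thesis
    unfolding continuous_on_sequentially
  proof (intro ballI allI impI, elim conjE)
    fix s u assume s: "\<forall>n. s n \<in> {0..T}" and u: "u \<in> {0..T}" and lim: "s \<longlonglongrightarrow> u"
    interpret finite_measure pm by (rule finite_pm)
    show "((\<lambda>t. running X t x) \<circ> s) \<longlonglongrightarrow> running X u x"
      unfolding running_def comp_def
    proof (rule integral_dominated_convergence)
      show "integrable pm (\<lambda>\<omega>. \<bar>\<Phi> x\<bar> + l * h \<omega>)" using h by simp
      show "AE \<omega> in pm. (\<lambda>n. \<Phi> (x - X (s n) \<omega>)) \<longlonglongrightarrow> \<Phi> (x - X u \<omega>)"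
      proof (rule AE_I2)
        fix \<omega> assume "\<omega> \<in> space pm"
        then have "continuous_on {0..T} (\<lambda>t. X t \<omega>)" using X by (auto simp: flow_def)
        then have "continuous_on {0..T} (\<lambda>t. \<Phi> (x - X t \<omega>))"
          by (intro continuous_on_compose2[OF \<Phi>_continuous] continuous_intros) auto
        then show "(\<lambda>n. \<Phi> (x - X (s n) \<omega>)) \<longlonglongrightarrow> \<Phi> (x - X u \<omega>)"
          using s u lim by (auto simp: continuous_on_sequentially comp_def)
      qed
      show "AE \<omega> in pm. norm (\<Phi> (x - X (s n) \<omega>)) \<le> \<bar>\<Phi> x\<bar> + l * h \<omega>" for n
      proof (rule AE_I2)
        fix \<omega> assume "\<omega> \<in> space pm"
        then have "l * norm (X (s n) \<omega>) \<le> l * h \<omega>"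
          using h(2)[of "s n" \<omega>] s l_nonneg by (intro mult_left_mono) auto
        then show "norm (\<Phi> (x - X (s n) \<omega>)) \<le> \<bar>\<Phi> x\<bar> + l * h \<omega>"
          using \<Phi>_lip[of "x - X (s n) \<omega>" x] by simp
      qed
    qed (use s u \<Phi>_flow_integrable[OF X] in auto)
  qed
qed

text \<open>At a fixed position the potential is continuous in \<open>t\<close> by dominated
  convergence, and its Lipschitz constant in the position is the same for all \<open>t\<close>. The
  two together give continuity along a moving point.\<close>

lemma running_path_continuous:
  assumes X: "flow X" and y: "continuous_on {0..T} y"
  shows "continuous_on {0..T} (\<lambda>t. running X t (y t))"
proof (rule continuous_onI)
  fix u e :: real assume u: "u \<in> {0..T}" and e: "0 < e"
  have "continuous_on {0..T} (\<lambda>t. \<bar>running X t (y u) - running X u (y u)\<bar> + l * norm (y t - y u))"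
    by (intro continuous_intros running_continuous X y)
  from this[unfolded continuous_on_iff, rule_format, OF u e]
  obtain d where d: "d > 0" "\<And>t. t \<in> {0..T} \<Longrightarrow> dist t u < d \<Longrightarrow>
      dist (\<bar>running X t (y u) - running X u (y u)\<bar> + l * norm (y t - y u)) 0 < e"
    by auto
  show "\<exists>d>0. \<forall>t\<in>{0..T}. dist t u < d \<longrightarrow> dist (running X t (y t)) (running X u (y u)) \<le> e"
  proof (intro exI conjI ballI impI)
    fix t assume t: "t \<in> {0..T}" "dist t u < d"
    have "0 \<le> l * norm (y t - y u)" using l_nonneg by simp
    then show "dist (running X t (y t)) (running X u (y u)) \<le> e"
      using d(2)[OF t] running_Lipschitz[OF X t(1), of "y t" "y u"] by (simp add: dist_real_def)
  qed fact
qed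

lemma running_path_integrable:
  assumes "flow X" "integrable tm A"
  shows "integrable tm (\<lambda>t. running X t (state_path T q A t))"
  by (intro continuous_imp_integrable_real running_path_continuous[OF assms(1)] continuous_on_state_path[OF assms(2)])

section \<open>Strong convexity of the individual cost\<close>

lemma admissible_midpoint:
  assumes A: "admissible A" and B: "admissible B"
  shows "admissible (\<lambda>t. (1/2) *\<^sub>R (A t + B t))"
proof -
  let ?C = "\<lambda>t. (1/2) *\<^sub>R (A t + B t)"
  have i: "integrable tm A" "integrable tm B" using A B by (auto simp: admissible_def)
  then have C: "integrable tm ?C" by auto
  moreover have "integrable tm (\<lambda>t. L (0, ?C t))"
  proof (rule Bochner_Integration.integrable_bound)
    show "integrable tm (\<lambda>t. (L (0, A t) + L (0, B t)) / 2)"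
      using A B by (auto simp: admissible_def)
    show "(\<lambda>t. L (0, ?C t)) \<in> borel_measurable tm"
      using C by (intro L_path_measurable continuous_on_const) auto
    have "norm (L (0, ?C t)) \<le> norm ((L (0, A t) + L (0, B t)) / 2)" for t
    proof -
      have "0 \<le> lam / 8 * (norm (A t - B t))\<^sup>2" using lam_pos by simp
      then show ?thesis
        using L_mid[of 0 0 "A t" "B t"] L_nonneg[of "(0, ?C t)"] L_nonneg[of "(0, A t)"] L_nonneg[of "(0, B t)"]
        by (simp add: field_simps)
    qed
    then show "AE t in tm. norm (L (0, ?C t)) \<le> norm ((L (0, A t) + L (0, B t)) / 2)" by simp
  qed
  ultimately show ?thesis by (simp add: admissible_def)
qed

text \<open>The constant is \<open>lam/8\<close> minus the defect \<open>(T\<^sup>2 MP + T MQ)/8 \<le> lam/32\<close>.\<close>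

lemma J_midpoint:
  assumes X: "flow X" and A: "admissible A" and B: "admissible B"
  shows "J X q (\<lambda>t. (1/2) *\<^sub>R (A t + B t)) \<le> (J X q A + J X q B) / 2 - 3 * lam / 32 * energy A B"
proof -
  interpret tm: finite_measure tm by (rule finite_tm)
  let ?C = "\<lambda>t. (1/2) *\<^sub>R (A t + B t)"
  define y z w where "y = state_path T q A" and "z = state_path T q B" and "w = state_path T q ?C"
  have iA: "integrable tm A" and iB: "integrable tm B" using A B by (auto simp: admissible_def)
  have C: "admissible ?C" by (rule admissible_midpoint[OF A B])
  then have iC: "integrable tm ?C" by (simp add: admissible_def)
  have w: "w t = (1/2) *\<^sub>R (y t + z t)" if "0 \<le> t" for t
    unfolding w_def y_def z_def by (rule state_path_midpoint[OF iA iB that])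
  have yz: "(norm (y t - z t))\<^sup>2 \<le> T * energy A B" if "0 \<le> t" for t
    unfolding y_def z_def by (rule path_diff_energy[OF A B that])
  have iL: "integrable tm (\<lambda>t. L (y t, A t))" "integrable tm (\<lambda>t. L (z t, B t))" "integrable tm (\<lambda>t. L (w t, ?C t))"
    unfolding y_def z_def w_def by (rule admissible_path_integrable[OF A] admissible_path_integrable[OF B] admissible_path_integrable[OF C])+
  have iR: "integrable tm (\<lambda>t. running X t (y t))" "integrable tm (\<lambda>t. running X t (z t))" "integrable tm (\<lambda>t. running X t (w t))"
    unfolding y_def z_def w_def by (rule running_path_integrable[OF X] iA iB iC)+
  note iE = admissible_diff_square_integrable[OF A B]
  have "(\<integral>t. L (w t, ?C t) \<partial>tm)
      \<le> (\<integral>t. (L (y t, A t) + L (z t, B t)) / 2 - lam / 8 * (norm (A t - B t))\<^sup>2 \<partial>tm)"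
    using iL iE w L_mid by (intro integral_mono) auto
  also have "\<dots> = ((\<integral>t. L (y t, A t) \<partial>tm) + (\<integral>t. L (z t, B t) \<partial>tm)) / 2 - lam / 8 * energy A B"
    using iL iE by (simp add: energy_def)
  finally have 1: "(\<integral>t. L (w t, ?C t) \<partial>tm) \<le> \<dots>" .
  have "(\<integral>t. running X t (w t) \<partial>tm)
      \<le> (\<integral>t. (running X t (y t) + running X t (z t)) / 2 + MP / 8 * (T * energy A B) \<partial>tm)"
  proof (rule integral_mono)
    fix t assume "t \<in> space tm"
    then have t: "t \<in> {0..T}" by simp
    have "MP / 8 * (norm (y t - z t))\<^sup>2 \<le> MP / 8 * (T * energy A B)"
      using yz[of t] t MP_nonneg by (intro mult_left_mono) auto
    then show "running X t (w t) \<le> (running X t (y t) + running X t (z t)) / 2 + MP / 8 * (T * energy A B)"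
      using running_midpoint[OF X t, of "y t" "z t"] w[of t] t by simp
  qed (use iR in auto)
  \<comment> \<open>One factor \<open>T\<close> comes from the bound on the distance of the paths,
    the other from integrating over time.\<close>
  also have "\<dots> = ((\<integral>t. running X t (y t) \<partial>tm) + (\<integral>t. running X t (z t) \<partial>tm)) / 2 + T\<^sup>2 * MP / 8 * energy A B"
    using iR by (simp add: measure_tm power2_eq_square)
  finally have 2: "(\<integral>t. running X t (w t) \<partial>tm) \<le> \<dots>" .
  have "MQ / 8 * (norm (y 0 - z 0))\<^sup>2 \<le> MQ / 8 * (T * energy A B)"
    using yz[of 0] MQ_nonneg by (intro mult_left_mono) auto
  then have 3: "initial X (w 0) \<le> (initial X (y 0) + initial X (z 0)) / 2 + T * MQ / 8 * energy A B"
    using initial_midpoint[OF X, of "y 0" "z 0"] w[of 0] by (simp add: algebra_simps)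
  have 4: "(T\<^sup>2 * MP + T * MQ) * energy A B \<le> lam / 4 * energy A B"
    by (rule mult_right_mono[OF small energy_nonneg])
  show ?thesis
    using 1 2 3 4 unfolding J_def y_def[symmetric] z_def[symmetric] w_def[symmetric]
    by (simp add: algebra_simps add_divide_distrib)
qed

text \<open>Quadratic growth around a minimiser: optimality of \<open>A\<close> is tested against
  the midpoint of \<open>A\<close> and \<open>B\<close>. Doubling the constant 3/32 of the midpoint
  inequality gives 3/16.\<close>

lemma optimal_gap:
  assumes "flow X" "optimal X q A" "admissible B"
  shows "3 * lam / 16 * energy A B \<le> J X q B - J X q A"
proof -
  have "admissible A" using assms by (simp add: optimal_def)
  then have "J X q A \<le> J X q (\<lambda>t. (1/2) *\<^sub>R (A t + B t))"
    using assms admissible_midpoint by (simp add: optimal_def)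
  then show ?thesis
    using J_midpoint[OF assms(1) \<open>admissible A\<close> assms(3), of q] by (simp add: field_simps)
qed

lemma L1_le_sqrt_energy:
  assumes "admissible A" "admissible B"
  shows "(\<integral>t. norm (A t - B t) \<partial>tm) \<le> sqrt (T * energy A B)"
proof -
  interpret finite_measure tm by (rule finite_tm)
  have "(\<integral>t. norm (A t - B t) \<partial>tm)\<^sup>2 \<le> T * energy A B"
    using integral_norm_square_le[of "\<lambda>t. A t - B t"] admissible_diff_square_integrable[OF assms] assms
    by (auto simp: energy_def measure_tm admissible_def)
  then show ?thesis by (rule real_le_rsqrt)
qed

lemma running_path_diff:
  assumes X: "flow X" and y: "continuous_on {0..T} y" and z: "continuous_on {0..T} z"
    and b: "\<And>t. t \<in> {0..T} \<Longrightarrow> norm (y t - z t) \<le> b"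
  shows "\<bar>(\<integral>t. running X t (y t) \<partial>tm) - (\<integral>t. running X t (z t) \<partial>tm)\<bar> \<le> T * l * b"
proof -
  interpret finite_measure tm by (rule finite_tm)
  have i: "integrable tm (\<lambda>t. running X t (y t))" "integrable tm (\<lambda>t. running X t (z t))"
    by (intro continuous_imp_integrable_real running_path_continuous[OF X] y z)+
  have "\<bar>\<integral>t. running X t (y t) - running X t (z t) \<partial>tm\<bar> \<le> (\<integral>t. l * b \<partial>tm)"
  proof (rule integral_abs_bound_integral)
    fix t assume "t \<in> space tm"
    then have t: "t \<in> {0..T}" by simp
    have "l * norm (y t - z t) \<le> l * b" by (intro mult_left_mono b t l_nonneg)
    then show "\<bar>running X t (y t) - running X t (z t)\<bar> \<le> l * b"
      using running_Lipschitz[OF X t, of "y t" "z t"] by simp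
  qed (use i in auto)
  then show ?thesis using i by (simp add: measure_tm)
qed

section \<open>Existence of optimal controls\<close>

lemma J_ge:
  assumes X: "flow X" and A: "admissible A"
  shows "(\<integral>t. L (state_path T q A t, A t) \<partial>tm) + T * m + m \<le> J X q A"
proof -
  interpret finite_measure tm by (rule finite_tm)
  have "(\<integral>t. m \<partial>tm) \<le> (\<integral>t. running X t (state_path T q A t) \<partial>tm)"
    using A by (intro integral_mono running_path_integrable[OF X] running_ge[OF X])
      (auto simp: admissible_def)
  then have "T * m \<le> (\<integral>t. running X t (state_path T q A t) \<partial>tm)" by (simp add: measure_tm)
  moreover have "m \<le> initial X (state_path T q A 0)" by (rule initial_ge[OF X])
  ultimately show ?thesis by (simp add: J_def)
qed

lemma J_lower_bound:
  assumes "flow X" "admissible A"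
  shows "T * m + m \<le> J X q A"
proof -
  have "0 \<le> (\<integral>t. L (state_path T q A t, A t) \<partial>tm)" by (simp add: L_nonneg)
  then show ?thesis using J_ge[OF assms, of q] by simp
qed

text \<open>Along the minimising sequence the paths converge uniformly, so both interaction terms
  converge by their Lipschitz bounds. The controls converge almost everywhere, and Fatou's lemma
  gives lower semicontinuity of the integral of \<open>L\<close>.\<close>

theorem optimal_exists:
  assumes X: "flow X"
  shows "\<exists>A. optimal X q A"
proof -
  interpret finite_measure tm by (rule finite_tm)
  define I where "I = Inf (J X q ` Collect admissible)"
  have bdd: "bdd_below (J X q ` Collect admissible)"
    using J_lower_bound[OF X] by (intro bdd_belowI[of _ "T * m + m"]) auto
  have I_le: "I \<le> J X q B" if "admissible B" for B
    unfolding I_def using that by (intro cInf_lower bdd) auto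
  \<comment> \<open>The rate is chosen so that its square root \<open>(1/2)^n\<close> is summable: a
    cost gap controls a squared distance.\<close>
  have "\<exists>A. admissible A \<and> J X q A < I + (1/4)^n" for n :: nat
  proof -
    have "Inf (J X q ` Collect admissible) < I + (1/4)^n" by (simp add: I_def)
    then show ?thesis
      using cInf_lessD[of "J X q ` Collect admissible" "I + (1/4)^n"] admissible_zero by auto
  qed
  then obtain A where A: "\<And>n. admissible (A n)" and JA: "\<And>n. J X q (A n) < I + (1/4)^n"
    by metis
  have iA: "integrable tm (A n)" for n using A by (auto simp: admissible_def)
  \<comment> \<open>The inverse of the constant \<open>3 * lam / 32\<close> of
    \<open>J_midpoint\<close>, times the factor \<open>T\<close> from Cauchy-Schwarz.\<close>
  define K where "K = sqrt (T * (32 / (3 * lam)))"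
  have L1: "(\<integral>t. norm (A (Suc n) t - A n t) \<partial>tm) \<le> K * (1/2)^n" for n
  proof -
    have "3 * lam / 32 * energy (A (Suc n)) (A n) \<le> (J X q (A (Suc n)) + J X q (A n)) / 2 - I"
      using J_midpoint[OF X A A, of q "Suc n" n] I_le[OF admissible_midpoint[OF A A, of "Suc n" n]] by linarith
    also have "\<dots> \<le> (1/4)^n"
    proof -
      have "(1/4::real)^Suc n = (1/4)^n / 4" "0 \<le> (1/4::real)^n" by simp_all
      then show ?thesis using JA[of n] JA[of "Suc n"] by argo
    qed
    finally have "T * energy (A (Suc n)) (A n) \<le> T * (32 / (3 * lam)) * (1/4)^n"
      using T_pos lam_pos by (simp add: field_simps)
    then have "sqrt (T * energy (A (Suc n)) (A n)) \<le> K * sqrt ((1/4)^n)"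
      unfolding K_def real_sqrt_mult[symmetric] by simp
    also have "sqrt ((1/4)^n) = (1/2)^n"
      by (rule real_sqrt_unique) (simp_all add: power2_eq_square flip: power_mult_distrib)
    finally show ?thesis using L1_le_sqrt_energy[OF A A, of "Suc n" n] by simp
  qed
  have "summable (\<lambda>n. \<integral>t. norm (A (Suc n) t - A n t) \<partial>tm)"
  proof (rule summable_comparison_test')
    show "summable (\<lambda>n. K * (1/2)^n)" by (intro summable_mult summable_geometric) simp
    show "norm (\<integral>t. norm (A (Suc n) t - A n t) \<partial>tm) \<le> K * (1/2)^n" if "0 \<le> n" for n
      using L1[of n] by simp
  qed
  then obtain F where F: "integrable tm F" and ae: "AE t in tm. (\<lambda>n. A n t) \<longlonglongrightarrow> F t"
    and L1lim: "(\<lambda>n. \<integral>t. norm (A n t - F t) \<partial>tm) \<longlonglongrightarrow> 0"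
    using L1_fast_Cauchy_limit[of tm A] iA by blast
  define y where "y n = state_path T q (A n)" for n
  define z where "z = state_path T q F"
  define e where "e n = (\<integral>t. norm (A n t - F t) \<partial>tm)" for n
  have yz: "norm (y n t - z t) \<le> e n" if "t \<in> {0..T}" for n t
    unfolding y_def z_def e_def using state_path_diff[OF iA F, of t q n q] that by simp
  have yc: "continuous_on {0..T} (y n)" and zc: "continuous_on {0..T} z" for n
    unfolding y_def z_def by (intro continuous_on_state_path iA F)+
  have e0: "e \<longlonglongrightarrow> 0" using L1lim by (simp add: e_def[abs_def])
  define R where "R n = (\<integral>t. running X t (y n t) \<partial>tm)" for n
  define G where "G n = initial X (y n 0)" for n
  define Rz Gz where "Rz = (\<integral>t. running X t (z t) \<partial>tm)" and "Gz = initial X (z 0)"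
  have Rlim: "R \<longlonglongrightarrow> Rz"
  proof (rule LIM_zero_cancel, rule Lim_null_comparison)
    show "\<forall>\<^sub>F n in sequentially. norm (R n - Rz) \<le> T * l * e n"
      unfolding R_def Rz_def using running_path_diff[OF X yc zc yz] by simp
    show "(\<lambda>n. T * l * e n) \<longlonglongrightarrow> 0" using e0 tendsto_mult_right_zero by blast
  qed
  have Glim: "G \<longlonglongrightarrow> Gz"
  proof (rule LIM_zero_cancel, rule Lim_null_comparison)
    show "\<forall>\<^sub>F n in sequentially. norm (G n - Gz) \<le> l * e n"
    proof (rule always_eventually, rule allI)
      fix n
      have "l * norm (y n 0 - z 0) \<le> l * e n"
        using zero_in_time by (intro mult_left_mono yz l_nonneg)
      then show "norm (G n - Gz) \<le> l * e n"
        unfolding G_def Gz_def using initial_Lipschitz[OF X, of "y n 0" "z 0"] by simp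
    qed
    show "(\<lambda>n. l * e n) \<longlonglongrightarrow> 0" using e0 tendsto_mult_right_zero by blast
  qed
  have Jlim: "(\<lambda>n. J X q (A n)) \<longlonglongrightarrow> I"
  proof (rule tendsto_sandwich)
    show "\<forall>\<^sub>F n in sequentially. I \<le> J X q (A n)" using I_le A by simp
    show "\<forall>\<^sub>F n in sequentially. J X q (A n) \<le> I + (1/4)^n"
      using JA by (intro always_eventually allI less_imp_le)
    have "(\<lambda>n. (1/4::real)^n) \<longlonglongrightarrow> 0" by (rule LIMSEQ_power_zero) simp
    then show "(\<lambda>n. I + (1/4)^n) \<longlonglongrightarrow> I" using tendsto_add[OF tendsto_const] by fastforce
  qed simp
  \<comment> \<open>The total cost and the two interaction terms converge, so this remaining part
    converges too and its lower limit in Fatou's lemma is explicit.\<close>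
  define u where "u n = (\<integral>t. L (y n t, A n t) \<partial>tm)" for n
  have u_eq: "u n = J X q (A n) - R n - G n" for n
    by (simp add: u_def J_def R_def G_def y_def)
  have ulim: "u \<longlonglongrightarrow> I - Rz - Gz"
    unfolding u_eq[abs_def] by (intro tendsto_diff Jlim Rlim Glim)
  have u0: "0 \<le> u n" for n by (simp add: u_def L_nonneg)
  \<comment> \<open>\<open>ennreal\<close> sends negative reals to 0; nonnegativity makes the final
    inequality valid again in the reals.\<close>
  have lim0: "0 \<le> I - Rz - Gz" using LIMSEQ_le_const[OF ulim] u0 by blast
  have Lint: "integrable tm (\<lambda>t. L (y n t, A n t))" for n
    unfolding y_def by (rule admissible_path_integrable[OF A])
  have zF[measurable]: "(\<lambda>t. L (z t, F t)) \<in> borel_measurable tm"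
    using F zc by (intro L_path_measurable) auto
  have "(\<integral>\<^sup>+t. ennreal (L (z t, F t)) \<partial>tm) = (\<integral>\<^sup>+t. liminf (\<lambda>n. ennreal (L (y n t, A n t))) \<partial>tm)"
  proof (rule nn_integral_cong_AE)
    have "AE t in tm. t \<in> {0..T}" by (rule AE_I2) simp
    with ae show "AE t in tm. ennreal (L (z t, F t)) = liminf (\<lambda>n. ennreal (L (y n t, A n t)))"
    proof eventually_elim
      case (elim t)
      have "(\<lambda>n. y n t) \<longlonglongrightarrow> z t"
        by (rule LIM_zero_cancel, rule Lim_null_comparison[OF _ e0]) (use yz elim in auto)
      then have "(\<lambda>n. (y n t, A n t)) \<longlonglongrightarrow> (z t, F t)" using elim by (intro tendsto_Pair)
      then have "(\<lambda>n. L (y n t, A n t)) \<longlonglongrightarrow> L (z t, F t)"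
        using L_cont continuous_on_tendsto_compose[OF L_cont] by fastforce
      then have "(\<lambda>n. ennreal (L (y n t, A n t))) \<longlonglongrightarrow> ennreal (L (z t, F t))"
        by (rule tendsto_ennrealI)
      then show ?case by (intro lim_imp_Liminf[symmetric]) auto
    qed
  qed
  also have "\<dots> \<le> liminf (\<lambda>n. \<integral>\<^sup>+t. ennreal (L (y n t, A n t)) \<partial>tm)"
    using Lint by (intro nn_integral_liminf) auto
  also have "(\<lambda>n. \<integral>\<^sup>+t. ennreal (L (y n t, A n t)) \<partial>tm) = (\<lambda>n. ennreal (u n))"
    unfolding u_def by (intro ext nn_integral_eq_integral Lint) (simp add: L_nonneg)
  also have "liminf (\<lambda>n. ennreal (u n)) = ennreal (I - Rz - Gz)"
    by (intro lim_imp_Liminf tendsto_ennrealI ulim) simp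
  finally have le: "(\<integral>\<^sup>+t. ennreal (L (z t, F t)) \<partial>tm) \<le> ennreal (I - Rz - Gz)" .
  have i: "integrable tm (\<lambda>t. L (z t, F t))"
  proof (rule integrableI_bounded[OF zF])
    have "(\<integral>\<^sup>+t. ennreal (norm (L (z t, F t))) \<partial>tm) = (\<integral>\<^sup>+t. ennreal (L (z t, F t)) \<partial>tm)"
      by (simp add: L_nonneg)
    also have "\<dots> < \<infinity>" using le by (simp add: le_less_trans)
    finally show "(\<integral>\<^sup>+t. ennreal (norm (L (z t, F t))) \<partial>tm) < \<infinity>" .
  qed
  then have adm: "admissible F"
    using L_path_integrable_transfer[OF F zc _ i, of "\<lambda>_. 0"] F by (simp add: admissible_def)
  have "ennreal (\<integral>t. L (z t, F t) \<partial>tm) \<le> ennreal (I - Rz - Gz)"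
    using le nn_integral_eq_integral[OF i] by (simp add: L_nonneg)
  then have "(\<integral>t. L (z t, F t) \<partial>tm) \<le> I - Rz - Gz"
    using lim0 by (simp add: ennreal_le_iff)
  then have "J X q F \<le> I" by (simp add: J_def Rz_def Gz_def z_def)
  then have "optimal X q F" using adm I_le by (force simp: optimal_def)
  then show ?thesis by blast
qed

section \<open>Stability of optimal controls\<close>

lemma optimal_cong_AE:
  assumes A: "optimal X q A" and B: "integrable tm B" and AB: "AE t in tm. A t = B t"
  shows "optimal X q B"
proof -
  have iA: "integrable tm A" "integrable tm (\<lambda>t. L (0, A t))"
    using A by (auto simp: optimal_def admissible_def)
  have m: "(\<lambda>t. L (y t, B t)) \<in> borel_measurable tm" if "continuous_on {0..T} y" for y
    using B that by (intro L_path_measurable) auto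
  have m': "(\<lambda>t. L (y t, A t)) \<in> borel_measurable tm" if "continuous_on {0..T} y" for y
    using iA that by (intro L_path_measurable) auto
  have "integrable tm (\<lambda>t. L (0, B t))"
    using iA(2) m[OF continuous_on_const, of 0] AB
    by (subst integrable_cong_AE[of _ _ "\<lambda>t. L (0, A t)"]) auto
  then have adm: "admissible B" using B by (simp add: admissible_def)
  have path: "state_path T q B t = state_path T q A t" if "0 \<le> t" for t
    using state_path_cong_AE[OF AB that iA(1) B, of q] by simp
  have "(\<integral>t. L (state_path T q B t, B t) \<partial>tm) = (\<integral>t. L (state_path T q A t, A t) \<partial>tm)"
  proof (rule integral_cong_AE)
    have "AE t in tm. t \<in> {0..T}" by (rule AE_I2) simp
    with AB show "AE t in tm. L (state_path T q B t, B t) = L (state_path T q A t, A t)"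
      by eventually_elim (simp add: path)
  qed (intro m m' continuous_on_state_path B iA)+
  moreover have "(\<integral>t. running X t (state_path T q B t) \<partial>tm) = (\<integral>t. running X t (state_path T q A t) \<partial>tm)"
    by (intro Bochner_Integration.integral_cong) (auto simp: path)
  ultimately have "J X q B = J X q A" by (simp add: J_def path)
  then show ?thesis using A adm by (simp add: optimal_def)
qed

text \<open>With the control kept, the whole path is translated by \<open>q - q'\<close>. The
  Lipschitz constants of \<open>L\<close> and \<open>\<Phi>\<close> are collected over time
  \<open>T\<close>, that of \<open>\<Psi>\<close> once at time 0.\<close>

lemma J_shift:
  assumes X: "flow X" and A: "admissible A"
  shows "\<bar>J X q A - J X q' A\<bar> \<le> (T * c1 + T * l + l) * norm (q - q')"
proof -
  interpret finite_measure tm by (rule finite_tm)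
  let ?y = "state_path T q A" and ?z = "state_path T q' A"
  have d: "?y t - ?z t = q - q'" for t by (simp add: state_path_def)
  have c: "continuous_on {0..T} ?y" "continuous_on {0..T} ?z"
    using A by (auto intro!: continuous_on_state_path simp: admissible_def)
  note i = admissible_path_integrable[OF A, of q] admissible_path_integrable[OF A, of q']
  have "\<bar>\<integral>t. L (?y t, A t) - L (?z t, A t) \<partial>tm\<bar> \<le> (\<integral>t. c1 * norm (q - q') \<partial>tm)"
  proof (rule integral_abs_bound_integral)
    show "\<bar>L (?y t, A t) - L (?z t, A t)\<bar> \<le> c1 * norm (q - q')" for t
      using L_lip[of "?y t" "A t" "?z t"] by (simp add: d)
  qed (use i in auto)
  then have "\<bar>(\<integral>t. L (?y t, A t) \<partial>tm) - (\<integral>t. L (?z t, A t) \<partial>tm)\<bar> \<le> T * c1 * norm (q - q')"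
    using i by (simp add: measure_tm)
  moreover have "\<bar>(\<integral>t. running X t (?y t) \<partial>tm) - (\<integral>t. running X t (?z t) \<partial>tm)\<bar> \<le> T * l * norm (q - q')"
    by (rule running_path_diff[OF X c]) (simp add: d)
  moreover have "\<bar>initial X (?y 0) - initial X (?z 0)\<bar> \<le> l * norm (q - q')"
    using initial_Lipschitz[OF X, of "?y 0" "?z 0"] by (simp add: d)
  ultimately show ?thesis
    unfolding J_def by (simp add: algebra_simps abs_le_iff)
qed

text \<open>Each control competes in the problem of the other. When the two gaps are added, the
  costs pair off into shifts of one and the same control. A squared distance is thus bounded
  linearly, which means Hoelder exponent 1/2 for the L^2 distance of controls.\<close>

lemma optimal_Hoelder:
  assumes X: "flow X" and A: "optimal X q A" and B: "optimal X q' B"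
  shows "3 * lam / 16 * energy A B \<le> (T * c1 + T * l + l) * norm (q - q')"
proof -
  have adm: "admissible A" "admissible B" using A B by (auto simp: optimal_def)
  have "3 * lam / 16 * energy A B \<le> J X q B - J X q A"
    by (rule optimal_gap[OF X A adm(2)])
  moreover have "3 * lam / 16 * energy A B \<le> J X q' A - J X q' B"
    using optimal_gap[OF X B adm(1)] by (simp add: energy_commute)
  ultimately show ?thesis
    using J_shift[OF X adm(1), of q q'] J_shift[OF X adm(2), of q q'] by linarith
qed

text \<open>The quantity \<open>sqrt (T * energy A B)\<close> bounds the distance of the two paths
  at every time. The two gaps contribute \<open>3 * lam / 8\<close> to the left side, smallness
  leaves at most \<open>lam / 4\<close> on the right, and the quotient is 2/3. Since
  \<open>S\<close> bounds only the mean over labels, the estimate serves sup norms and L^1 norms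
  alike.\<close>

lemma optimal_flow_comparison:
  assumes X: "flow X" and Y: "flow Y"
    and S: "\<And>t. t \<in> {0..T} \<Longrightarrow> (\<integral>\<omega>. norm (X t \<omega> - Y t \<omega>) \<partial>pm) \<le> S"
    and A: "optimal X q A" and B: "optimal Y q B"
  shows "sqrt (T * energy A B) \<le> 2 / 3 * S"
proof -
  interpret finite_measure tm by (rule finite_tm)
  have adm: "admissible A" "admissible B" using A B by (auto simp: optimal_def)
  have iA: "integrable tm A" "integrable tm B" using adm by (auto simp: admissible_def)
  define \<delta> where "\<delta> = sqrt (T * energy A B)"
  define y z where "y = state_path T q A" and "z = state_path T q B"
  have \<delta>0: "0 \<le> \<delta>" using T_pos energy_nonneg by (simp add: \<delta>_def)
  have \<delta>2: "\<delta>\<^sup>2 = T * energy A B" using T_pos energy_nonneg by (simp add: \<delta>_def)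
  have yz: "norm (z t - y t) \<le> \<delta>" if "t \<in> {0..T}" for t
    unfolding y_def z_def \<delta>_def
    using path_diff_energy[OF adm(2,1), of t q] that by (intro real_le_rsqrt) (simp add: energy_commute)
  have "0 \<le> (\<integral>\<omega>. norm (X 0 \<omega> - Y 0 \<omega>) \<partial>pm)" by simp
  then have S0: "0 \<le> S" using S[OF zero_in_time] by linarith
  have bound: "K * norm (z t - y t) * (\<integral>\<omega>. norm (X t \<omega> - Y t \<omega>) \<partial>pm) \<le> K * \<delta> * S"
    if "t \<in> {0..T}" "0 \<le> K" for t K
    using that \<delta>0 by (intro mult_mono mult_left_mono yz S) auto
  have run: "\<bar>running X t (y t) - running Y t (y t) - (running X t (z t) - running Y t (z t))\<bar> \<le> MP * \<delta> * S"
    if t: "t \<in> {0..T}" for t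
    using average_diff2[OF \<Phi>_flow_integrable[OF X t] \<Phi>_flow_integrable[OF Y t]
        flow_integrable[OF X t] flow_integrable[OF Y t] \<Phi>_diff2, of "y t" "z t"]
      bound[OF t MP_nonneg] by (simp add: running_def)
  have init: "\<bar>initial X (y 0) - initial Y (y 0) - (initial X (z 0) - initial Y (z 0))\<bar> \<le> MQ * \<delta> * S"
    using average_diff2[OF \<Psi>_flow_integrable[OF X zero_in_time] \<Psi>_flow_integrable[OF Y zero_in_time]
        flow_integrable[OF X zero_in_time] flow_integrable[OF Y zero_in_time] \<Psi>_diff2, of "y 0" "z 0"]
      bound[OF zero_in_time MQ_nonneg] by (simp add: initial_def)
  have i: "integrable tm (\<lambda>t. running X t (y t))" "integrable tm (\<lambda>t. running X t (z t))"
    "integrable tm (\<lambda>t. running Y t (y t))" "integrable tm (\<lambda>t. running Y t (z t))"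
    unfolding y_def z_def by (rule running_path_integrable X Y iA)+
  have "\<bar>\<integral>t. running X t (y t) - running Y t (y t) - (running X t (z t) - running Y t (z t)) \<partial>tm\<bar>
      \<le> (\<integral>t. MP * \<delta> * S \<partial>tm)"
    using i run by (intro integral_abs_bound_integral) auto
  then have run': "\<bar>(\<integral>t. running X t (y t) \<partial>tm) - (\<integral>t. running Y t (y t) \<partial>tm)
      - ((\<integral>t. running X t (z t) \<partial>tm) - (\<integral>t. running Y t (z t) \<partial>tm))\<bar> \<le> T * MP * \<delta> * S"
    using i by (simp add: measure_tm)
  have "3 * lam / 16 * energy A B \<le> J X q B - J X q A"
    by (rule optimal_gap[OF X A adm(2)])
  moreover have "3 * lam / 16 * energy A B \<le> J Y q A - J Y q B"
    using optimal_gap[OF Y B adm(1)] by (simp add: energy_commute)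
  ultimately have "3 * lam / 8 * energy A B \<le> T * MP * \<delta> * S + MQ * \<delta> * S"
    using run' init unfolding J_def y_def[symmetric] z_def[symmetric] by linarith
  then have "T * (3 * lam / 8 * energy A B) \<le> T * (T * MP * \<delta> * S + MQ * \<delta> * S)"
    using T_pos by (intro mult_left_mono) auto
  then have "3 * lam / 8 * \<delta>\<^sup>2 \<le> (T\<^sup>2 * MP + T * MQ) * (\<delta> * S)"
    unfolding \<delta>2 by (simp add: algebra_simps power2_eq_square)
  also have "\<dots> \<le> lam / 4 * (\<delta> * S)"
    using small S0 \<delta>0 by (intro mult_right_mono) auto
  finally have "(lam / 8) * (3 * \<delta>\<^sup>2) \<le> (lam / 8) * (2 * (\<delta> * S))" by (simp add: algebra_simps)
  then have "3 * \<delta>\<^sup>2 \<le> 2 * (\<delta> * S)" using lam_pos by (simp only: mult_le_cancel_left)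
  then have "\<delta> * (3 * \<delta>) \<le> \<delta> * (2 * S)" by (simp add: power2_eq_square)
  then have "\<delta> \<le> 2 / 3 * S"
    using S0 \<delta>0 by (cases "\<delta> = 0") auto
  then show ?thesis by (simp add: \<delta>_def)
qed

subsection \<open>The equilibrium flow\<close>

lemma flow_bcontfun:
  fixes X :: "(real \<times> real) \<Rightarrow>\<^sub>C 'a"
  shows "flow (\<lambda>t \<omega>. X (t, \<omega>))"
proof -
  interpret finite_measure pm by (rule finite_pm)
  obtain b where b: "\<And>p. norm (X p) \<le> b"
    using bounded_apply_bcontfun[of X] by (auto simp: bounded_iff)
  have c: "continuous_on UNIV (apply_bcontfun X)" by simp
  have "continuous_on players (\<lambda>\<omega>. X (t, \<omega>))" for t
    by (intro continuous_on_compose2[OF c] continuous_intros) auto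
  then have "(\<lambda>\<omega>. X (t, \<omega>)) \<in> borel_measurable pm" for t
    by (rule continuous_imp_measurable_on_sets_lebesgue) simp
  moreover have "continuous_on {0..T} (\<lambda>t. X (t, \<omega>))" for \<omega>
    by (intro continuous_on_compose2[OF c] continuous_intros) auto
  moreover have "integrable pm (\<lambda>_. b)" by simp
  ultimately show ?thesis
    unfolding flow_def using b by (intro conjI ballI exI[of _ "\<lambda>_. b"]) auto
qed

text \<open>The bound of \<open>optimal_Hoelder\<close> solved for the energy and multiplied by
  \<open>T\<close>, as \<open>sqrt (T * energy A B)\<close> dominates both the L^1 distance of the
  controls and the distance of paths with the same end point.\<close>

definition modulus :: real where
  "modulus = T * (16 / (3 * lam)) * (T * c1 + T * l + l)"

lemma modulus_nonneg: "0 \<le> modulus"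
  using T_pos lam_pos c1_nonneg l_nonneg by (simp add: modulus_def)

lemma sqrt_energy_modulus:
  assumes "flow X" "optimal X q A" "optimal X q' B"
  shows "sqrt (T * energy A B) \<le> sqrt (modulus * norm (q - q'))"
proof -
  have "T * energy A B = T * (16 / (3 * lam)) * (3 * lam / 16 * energy A B)"
    using lam_pos by simp
  also have "\<dots> \<le> T * (16 / (3 * lam)) * ((T * c1 + T * l + l) * norm (q - q'))"
    using optimal_Hoelder[OF assms] T_pos lam_pos by (intro mult_left_mono) auto
  also have "\<dots> = modulus * norm (q - q')" by (simp only: modulus_def mult.assoc)
  finally show ?thesis by (rule real_sqrt_le_mono)
qed

lemma optimal_L1_modulus:
  assumes "flow X" "optimal X q A" "optimal X q' B"
  shows "(\<integral>t. norm (A t - B t) \<partial>tm) \<le> sqrt (modulus * norm (q - q'))"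
  using order_trans[OF L1_le_sqrt_energy sqrt_energy_modulus[OF assms]] assms by (simp add: optimal_def)

text \<open>The change of the path with the label is bounded uniformly in \<open>t\<close>, by the
  shift of the end point plus the Hoelder term. Together with continuity in time of the single path
  at \<open>\<omega>0\<close> this gives joint continuity.\<close>

lemma optimal_paths_continuous:
  fixes Xs :: "real \<Rightarrow> 'a"
  assumes X: "flow X" and Xs: "continuous_on {0..1} Xs"
    and B: "\<And>\<omega>. \<omega> \<in> {0..1} \<Longrightarrow> optimal X (Xs \<omega>) (B \<omega>)"
  shows "continuous_on ({0..T} \<times> {0..1}) (\<lambda>(t, \<omega>). state_path T (Xs \<omega>) (B \<omega>) t)"
  unfolding continuous_on_def
proof
  fix p0 assume p0: "p0 \<in> {0..T} \<times> {0..1::real}"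
  obtain t0 \<omega>0 where p0_eq: "p0 = (t0, \<omega>0)" by (cases p0)
  define r where "r \<omega> t = state_path T (Xs \<omega>) (B \<omega>) t" for \<omega> t
  have iB: "integrable tm (B \<omega>)" if "\<omega> \<in> {0..1}" for \<omega>
    using B[OF that] by (auto simp: optimal_def admissible_def)
  define g where "g = (\<lambda>(t, \<omega>). norm (Xs \<omega> - Xs \<omega>0) + sqrt (modulus * norm (Xs \<omega> - Xs \<omega>0))
      + norm (r \<omega>0 t - r \<omega>0 t0))"
  have Xc: "continuous_on ({0..T} \<times> {0..1}) (\<lambda>p. Xs (snd p))"
    by (intro continuous_on_compose2[OF Xs] continuous_intros) auto
  have rc: "continuous_on ({0..T} \<times> {0..1}) (\<lambda>p. r \<omega>0 (fst p))"
    unfolding r_def using p0 p0_eq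
    by (intro continuous_on_compose2[OF continuous_on_state_path[OF iB]] continuous_intros) auto
  have "continuous_on ({0..T} \<times> {0..1}) g"
    unfolding g_def case_prod_beta by (intro continuous_intros Xc rc)
  then have "(g \<longlongrightarrow> g p0) (at p0 within {0..T} \<times> {0..1})"
    using p0 unfolding continuous_on_def by blast
  then have g0: "(g \<longlongrightarrow> 0) (at p0 within {0..T} \<times> {0..1})" by (simp add: g_def p0_eq)
  have "norm ((case p of (t, \<omega>) \<Rightarrow> r \<omega> t) - (case p0 of (t, \<omega>) \<Rightarrow> r \<omega> t)) \<le> g p"
    if "p \<in> {0..T} \<times> {0..1}" for p
  proof -
    obtain t \<omega> where p: "p = (t, \<omega>)" by (cases p)
    have in1: "\<omega> \<in> {0..1}" "\<omega>0 \<in> {0..1}" "t \<in> {0..T}" using that p p0 p0_eq by auto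
    have "norm (r \<omega> t - r \<omega>0 t) \<le> norm (Xs \<omega> - Xs \<omega>0) + (\<integral>s. norm (B \<omega> s - B \<omega>0 s) \<partial>tm)"
      unfolding r_def using in1 by (intro state_path_diff iB) auto
    also have "\<dots> \<le> norm (Xs \<omega> - Xs \<omega>0) + sqrt (modulus * norm (Xs \<omega> - Xs \<omega>0))"
      using optimal_L1_modulus[OF X B B, OF in1(1,2)] by simp
    finally have "norm (r \<omega> t - r \<omega>0 t) \<le> \<dots>" .
    moreover have "norm (r \<omega> t - r \<omega>0 t0) \<le> norm (r \<omega> t - r \<omega>0 t) + norm (r \<omega>0 t - r \<omega>0 t0)"
      using norm_triangle_ineq[of "r \<omega> t - r \<omega>0 t" "r \<omega>0 t - r \<omega>0 t0"] by simp
    ultimately show ?thesis by (simp add: p p0_eq g_def)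
  qed
  then have "\<forall>\<^sub>F p in at p0 within {0..T} \<times> {0..1}.
      norm ((case p of (t, \<omega>) \<Rightarrow> r \<omega> t) - (case p0 of (t, \<omega>) \<Rightarrow> r \<omega> t)) \<le> g p"
    by (auto simp: eventually_at_filter)
  then have "((\<lambda>p. (case p of (t, \<omega>) \<Rightarrow> r \<omega> t) - (case p0 of (t, \<omega>) \<Rightarrow> r \<omega> t)) \<longlongrightarrow> 0)
      (at p0 within {0..T} \<times> {0..1})"
    by (rule Lim_null_comparison[OF _ g0])
  then show "((\<lambda>(t, \<omega>). state_path T (Xs \<omega>) (B \<omega>) t)
      \<longlongrightarrow> (case p0 of (t, \<omega>) \<Rightarrow> state_path T (Xs \<omega>) (B \<omega>) t)) (at p0 within {0..T} \<times> {0..1})"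
    unfolding r_def by (rule LIM_zero_cancel)
qed

text \<open>Banach's theorem applies to the best response as a self-map of the bounded continuous
  functions on the plane; the closed label interval makes the rectangle of times and labels compact,
  hence the response bounded.\<close>

theorem equilibrium_flow_exists:
  fixes Xs :: "real \<Rightarrow> 'a"
  assumes Xs: "continuous_on {0..1} Xs"
  obtains X B where "flow X" "\<And>\<omega>. \<omega> \<in> {0..1} \<Longrightarrow> optimal X (Xs \<omega>) (B \<omega>)"
    "\<And>t \<omega>. t \<in> {0..T} \<Longrightarrow> \<omega> \<in> {0..1} \<Longrightarrow> X t \<omega> = state_path T (Xs \<omega>) (B \<omega>) t"
proof -
  interpret finite_measure pm by (rule finite_pm)
  define fl where "fl X = (\<lambda>t \<omega>. apply_bcontfun X (t, \<omega>))" for X :: "(real \<times> real) \<Rightarrow>\<^sub>C 'a"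
  have fl: "flow (fl X)" for X unfolding fl_def by (rule flow_bcontfun)
  \<comment> \<open>Any choice serves, as the estimates below hold for arbitrary optimal controls of
    the problems concerned.\<close>
  define B where "B X \<omega> = (SOME A. optimal (fl X) (Xs \<omega>) A)" for X \<omega>
  have B: "optimal (fl X) (Xs \<omega>) (B X \<omega>)" for X \<omega>
    unfolding B_def by (rule someI_ex[OF optimal_exists[OF fl]])
  \<comment> \<open>Clamping to the rectangle extends the response, which is continuous only there,
    to the plane without enlarging its range.\<close>
  define pr where "pr p = (max 0 (min T (fst p)), max 0 (min 1 (snd p)))" for p :: "real \<times> real"
  have pr: "pr p \<in> {0..T} \<times> {0..1}" "p \<in> {0..T} \<times> {0..1} \<Longrightarrow> pr p = p" for p
    using T_pos by (auto simp: pr_def)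
  define r where "r X = (\<lambda>(t, \<omega>). state_path T (Xs \<omega>) (B X \<omega>) t)" for X
  have rc: "continuous_on ({0..T} \<times> {0..1}) (r X)" for X
    unfolding r_def by (rule optimal_paths_continuous[OF fl Xs B])
  have r_bcontfun: "(\<lambda>p. r X (pr p)) \<in> bcontfun" for X
  proof -
    have "continuous_on UNIV pr" unfolding pr_def by (intro continuous_intros)
    then have "continuous_on UNIV (\<lambda>p. r X (pr p))"
      by (rule continuous_on_compose2[OF rc]) (use pr in blast)
    moreover have "bounded (r X ` ({0..T} \<times> {0..1}))"
      by (intro compact_imp_bounded compact_continuous_image[OF rc] compact_Times) auto
    then have "bounded (range (\<lambda>p. r X (pr p)))"
      by (rule bounded_subset) (use pr in blast)
    ultimately show ?thesis by (simp add: bcontfun_def)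
  qed
  define R where "R X = Bcontfun (\<lambda>p. r X (pr p))" for X
  have R: "R X p = r X (pr p)" for X p
    unfolding R_def using r_bcontfun[of X] by (simp add: Bcontfun_inverse)
  have "dist (R X) (R Y) \<le> 2 / 3 * dist X Y" for X Y
  proof (rule dist_bound)
    fix p
    obtain t \<omega> where p: "pr p = (t, \<omega>)" by (cases "pr p")
    then have t: "t \<in> {0..T}" using pr(1)[of p] by auto
    have A: "optimal (fl X) (Xs \<omega>) (B X \<omega>)" "optimal (fl Y) (Xs \<omega>) (B Y \<omega>)" by (rule B)+
    have adm: "admissible (B X \<omega>)" "admissible (B Y \<omega>)" using A by (auto simp: optimal_def)
    have S: "(\<integral>\<omega>. norm (fl X t \<omega> - fl Y t \<omega>) \<partial>pm) \<le> dist X Y" if t: "t \<in> {0..T}" for t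
    proof -
      have "norm (fl X t \<omega> - fl Y t \<omega>) \<le> dist X Y" for \<omega>
        using dist_bounded[of X "(t, \<omega>)" Y] by (simp add: fl_def dist_norm)
      then have "(\<integral>\<omega>. norm (fl X t \<omega> - fl Y t \<omega>) \<partial>pm) \<le> (\<integral>\<omega>. dist X Y \<partial>pm)"
        using flow_integrable[OF fl t, of X] flow_integrable[OF fl t, of Y]
        by (intro integral_mono) auto
      then show ?thesis by (simp add: measure_pm)
    qed
    have "dist (R X p) (R Y p) = norm (state_path T (Xs \<omega>) (B X \<omega>) t - state_path T (Xs \<omega>) (B Y \<omega>) t)"
      by (simp add: R p r_def dist_norm)
    also have "\<dots> \<le> sqrt (T * energy (B X \<omega>) (B Y \<omega>))"
      using path_diff_energy[OF adm, of t "Xs \<omega>"] t by (intro real_le_rsqrt) simp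
    also have "\<dots> \<le> 2 / 3 * dist X Y"
      by (rule optimal_flow_comparison[OF fl fl S A])
    finally show "dist (R X p) (R Y p) \<le> 2 / 3 * dist X Y" .
  qed
  then have "\<exists>!X. R X = X" by (intro banach_fix_type[of "2/3"]) auto
  then obtain X where X: "R X = X" by blast
  show ?thesis
  proof (rule that[of "fl X" "B X"])
    fix t \<omega> assume "t \<in> {0..T}" "\<omega> \<in> {0..1::real}"
    then show "fl X t \<omega> = state_path T (Xs \<omega>) (B X \<omega>) t"
      using R[of X "(t, \<omega>)"] pr(2)[of "(t, \<omega>)"] by (simp add: X fl_def r_def)
  qed (rule fl B)+
qed

text \<open>Sampling \<open>\<omega>\<close> on grids so fine that the approximations converge summably in \<open>L\<^sup>1\<close>
  makes them converge for almost every \<open>t\<close>, for each single \<open>\<omega>\<close>.\<close>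

lemma measurable_optimal_selection:
  fixes Xs :: "real \<Rightarrow> 'a"
  assumes X: "flow X" and Xs: "continuous_on {0..1} Xs"
    and B: "\<And>\<omega>. \<omega> \<in> {0..1} \<Longrightarrow> optimal X (Xs \<omega>) (B \<omega>)"
  obtains \<alpha> :: "real \<Rightarrow> real \<Rightarrow> 'a"
  where "(\<lambda>(t, \<omega>). \<alpha> t \<omega>) \<in> borel_measurable borel"
    "\<And>\<omega>. \<omega> \<in> players \<Longrightarrow> AE t in tm. B \<omega> t = \<alpha> t \<omega>"
proof -
  have iB: "integrable tm (B \<omega>)" if "\<omega> \<in> {0..1}" for \<omega>
    using B[OF that] by (auto simp: optimal_def admissible_def)
  have "\<exists>C. C \<in> borel_measurable borel \<and> (\<omega> \<in> {0..1} \<longrightarrow> (AE t in tm. B \<omega> t = C t))" for \<omega>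
  proof (cases "\<omega> \<in> {0..1}")
    case True
    then obtain C where "C \<in> borel_measurable borel" "AE t in tm. B \<omega> t = C t"
      using ex_borel_version_lebesgue_on[OF borel_measurable_integrable[OF iB[OF True]]] by auto
    then show ?thesis by blast
  next
    case False
    then show ?thesis by (intro exI[of _ "\<lambda>_. 0"]) auto
  qed
  \<comment> \<open>These Borel versions are chosen label by label, with no regularity in
    \<open>\<omega>\<close>; joint measurability arises only from sampling.\<close>
  then obtain C where C: "\<And>\<omega>. C \<omega> \<in> borel_measurable borel"
    and BC: "\<And>\<omega>. \<omega> \<in> {0..1} \<Longrightarrow> AE t in tm. B \<omega> t = C \<omega> t"
    by metis
  have CT: "C \<omega> \<in> borel_measurable tm" for \<omega>
    using C[of \<omega>] by (intro measurable_restrict_space1 measurable_completion) simp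
  have iC: "integrable tm (C \<omega>)" if "\<omega> \<in> {0..1}" for \<omega>
    using iB[OF that] BC[OF that] CT by (subst integrable_cong_AE[of _ _ "B \<omega>"]) auto
  \<comment> \<open>At this mesh the Hoelder bound on the L^1 error becomes \<open>(1/2)^n\<close>,
    a summable sequence. As \<open>modulus\<close> may vanish, the proof divides by
    \<open>modulus + 1\<close>.\<close>
  have "\<exists>N. 0 < real N \<and> (\<forall>x\<in>{0..1}. \<forall>y\<in>{0..1}. \<bar>x - y\<bar> \<le> 1 / N \<longrightarrow> modulus * norm (Xs x - Xs y) \<le> (1/4)^n)" for n
  proof -
    define e where "e = (1/4)^n / (modulus + 1)"
    have e: "0 < e" using modulus_nonneg by (simp add: e_def)
    have "uniformly_continuous_on {0..1} Xs"
      using Xs by (rule compact_uniformly_continuous) simp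
    then obtain d where d: "0 < d" "\<And>x y. x \<in> {0..1} \<Longrightarrow> y \<in> {0..1} \<Longrightarrow> dist x y < d \<Longrightarrow> dist (Xs x) (Xs y) < e"
      using e unfolding uniformly_continuous_on_def by metis
    obtain N :: nat where N: "N \<noteq> 0" "inverse (real N) < d"
      using d(1) ex_inverse_of_nat_less by auto
    have "modulus * norm (Xs x - Xs y) \<le> (1/4)^n" if "x \<in> {0..1}" "y \<in> {0..1}" "\<bar>x - y\<bar> \<le> 1 / N" for x y
    proof -
      have "norm (Xs x - Xs y) \<le> e"
        using d(2)[of x y] that N by (simp add: dist_norm inverse_eq_divide)
      then have "modulus * norm (Xs x - Xs y) \<le> (modulus + 1) * e"
        using modulus_nonneg e by (intro mult_mono) auto
      then show ?thesis using modulus_nonneg by (simp add: e_def)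
    qed
    then show ?thesis using N(1) by (intro exI[of _ N]) auto
  qed
  then obtain N :: "nat \<Rightarrow> nat" where N0: "\<And>n. 0 < real (N n)"
    and N: "\<And>n x y. x \<in> {0..1} \<Longrightarrow> y \<in> {0..1} \<Longrightarrow> \<bar>x - y\<bar> \<le> 1 / N n \<Longrightarrow> modulus * norm (Xs x - Xs y) \<le> (1/4)^n"
    by metis
  \<comment> \<open>The grid point to the left of \<open>\<omega>\<close> can be 0, which is not a
    player; hence optimal controls are supposed on the closed interval.\<close>
  define g where "g n \<omega> = real_of_int \<lfloor>real (N n) * \<omega>\<rfloor> / real (N n)" for n and \<omega> :: real
  define f where "f n = (\<lambda>(t, \<omega>). C (g n \<omega>) t)" for n
  have g1: "g n \<omega> \<in> {0..1}" and g2: "\<bar>\<omega> - g n \<omega>\<bar> \<le> 1 / N n" if "\<omega> \<in> players" for n \<omega>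
  proof -
    have le: "real_of_int \<lfloor>N n * \<omega>\<rfloor> \<le> N n * \<omega>" by simp
    have gt: "N n * \<omega> \<le> real_of_int \<lfloor>N n * \<omega>\<rfloor> + 1" by (simp add: less_imp_le)
    have a: "g n \<omega> \<le> \<omega>" unfolding g_def using N0[of n] le by (simp add: divide_le_eq mult.commute)
    moreover have "0 \<le> g n \<omega>" unfolding g_def using that by simp
    ultimately show "g n \<omega> \<in> {0..1}" using that by auto
    have "\<omega> \<le> (real_of_int \<lfloor>N n * \<omega>\<rfloor> + 1) / N n"
      using N0[of n] gt by (simp add: le_divide_eq mult.commute)
    then show "\<bar>\<omega> - g n \<omega>\<bar> \<le> 1 / N n" using a by (simp add: g_def add_divide_distrib)
  qed
  \<comment> \<open>On each of the countably many strips where the integer part is constant,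
    \<open>f n\<close> is a Borel function of \<open>t\<close> alone.\<close>
  have f: "f n \<in> borel_measurable borel" for n
  proof -
    have "(\<lambda>p. C (real_of_int k / N n) (fst p)) \<in> borel_measurable (borel \<Otimes>\<^sub>M (borel :: real measure))" for k
      by (rule measurable_compose[OF measurable_fst C])
    moreover have "(\<lambda>p. \<lfloor>real (N n) * snd p\<rfloor>) \<in> (borel :: real measure) \<Otimes>\<^sub>M (borel :: real measure) \<rightarrow>\<^sub>M count_space UNIV"
    proof (rule measurable_compose[OF _ measurable_real_floor])
      show "(\<lambda>p. real (N n) * snd p) \<in> borel_measurable ((borel :: real measure) \<Otimes>\<^sub>M (borel :: real measure))"
        by (intro borel_measurable_times measurable_snd) simp
    qed
    ultimately have "(\<lambda>p. C (real_of_int \<lfloor>N n * snd p\<rfloor> / N n) (fst p)) \<in> borel_measurable (borel \<Otimes>\<^sub>M (borel :: real measure))"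
      by (rule measurable_compose_countable)
    then show ?thesis
      by (simp add: f_def g_def case_prod_beta borel_prod)
  qed
  \<comment> \<open>\<open>lim\<close> is total and preserves Borel measurability, so points of
    divergence call for no special treatment.\<close>
  define \<alpha> where "\<alpha> t \<omega> = lim (\<lambda>n. f n (t, \<omega>))" for t \<omega>
  show ?thesis
  proof (rule that)
    show "(\<lambda>(t, \<omega>). \<alpha> t \<omega>) \<in> borel_measurable borel"
      unfolding \<alpha>_def case_prod_beta prod.collapse using f by (rule borel_measurable_lim_metric)
    fix \<omega> :: real assume \<omega>: "\<omega> \<in> players"
    then have \<omega>1: "\<omega> \<in> {0..1}" by auto
    have le: "(\<integral>t. norm (f n (t, \<omega>) - B \<omega> t) \<partial>tm) \<le> (1/2)^n" for n
    proof -
      have "(\<integral>t. norm (f n (t, \<omega>) - B \<omega> t) \<partial>tm) = (\<integral>t. norm (B \<omega> t - B (g n \<omega>) t) \<partial>tm)"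
      proof (rule integral_cong_AE)
        show "AE t in tm. norm (f n (t, \<omega>) - B \<omega> t) = norm (B \<omega> t - B (g n \<omega>) t)"
          using BC[OF g1[OF \<omega>, of n]] by eventually_elim (simp add: f_def norm_minus_commute)
      qed (use CT iB[OF \<omega>1] iB[OF g1[OF \<omega>, of n]] in \<open>auto simp: f_def\<close>)
      also have "\<dots> \<le> sqrt (modulus * norm (Xs \<omega> - Xs (g n \<omega>)))"
        by (rule optimal_L1_modulus[OF X B[OF \<omega>1] B[OF g1[OF \<omega>]]])
      also have "\<dots> \<le> sqrt ((1/4)^n)"
        by (rule real_sqrt_le_mono[OF N[OF \<omega>1 g1[OF \<omega>] g2[OF \<omega>]]])
      also have "\<dots> = (1/2)^n"
        by (rule real_sqrt_unique) (simp_all add: power2_eq_square flip: power_mult_distrib)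
      finally show ?thesis .
    qed
    have "AE t in tm. (\<lambda>n. f n (t, \<omega>)) \<longlonglongrightarrow> B \<omega> t"
    proof (rule AE_tendsto_of_summable_L1)
      show "integrable tm (\<lambda>t. f n (t, \<omega>))" for n
        using iC[OF g1[OF \<omega>, of n]] by (simp add: f_def)
      show "summable (\<lambda>n. \<integral>t. norm (f n (t, \<omega>) - B \<omega> t) \<partial>tm)"
      proof (rule summable_comparison_test')
        show "summable (\<lambda>n. (1/2::real)^n)" by (intro summable_geometric) simp
        show "norm (\<integral>t. norm (f n (t, \<omega>) - B \<omega> t) \<partial>tm) \<le> (1/2)^n" if "0 \<le> n" for n
          using le[of n] by simp
      qed
    qed (rule iB[OF \<omega>1])
    then show "AE t in tm. B \<omega> t = \<alpha> t \<omega>"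
      unfolding \<alpha>_def by eventually_elim (simp add: limI)
  qed
qed

end

subsection \<open>The game\<close>

locale mfg_game = mfg L \<Phi> \<Psi> c0 c1 lam l m MP MQ T
  for L :: "'a::euclidean_space \<times> 'a \<Rightarrow> real" and \<Phi> \<Psi> c0 c1 lam l m MP MQ T +
  fixes Xs :: "real \<Rightarrow> 'a"
  assumes Xs_continuous: "continuous_on {0..1} Xs"
    and Xs_nonatomic: "\<And>q. {\<omega> \<in> players. Xs \<omega> = q} \<in> null_sets lebesgue"
begin

section \<open>The cost of a player against a frozen crowd\<close>

definition individual_cost :: "(real \<Rightarrow> real \<Rightarrow> 'a) \<Rightarrow> 'a \<Rightarrow> (real \<Rightarrow> 'a) \<Rightarrow> ereal" where
  "individual_cost X q A = enn2ereal (\<integral>\<^sup>+t. ennreal (L (state_path T q A t, A t)) \<partial>tm)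
     + ereal (\<integral>t. running X t (state_path T q A t) \<partial>tm) + ereal (initial X (state_path T q A 0))"

lemma individual_cost_admissible:
  "admissible A \<Longrightarrow> individual_cost X q A = ereal (J X q A)"
  using nn_integral_eq_integral[OF admissible_path_integrable[of A q]]
  by (simp add: individual_cost_def J_def L_nonneg)

lemma individual_cost_not_admissible:
  assumes A: "integrable tm A" and not_adm: "\<not> admissible A"
  shows "individual_cost X q A = \<infinity>"
proof -
  have c: "continuous_on {0..T} (state_path T q A)" by (rule continuous_on_state_path[OF A])
  have "(\<integral>\<^sup>+t. ennreal (L (state_path T q A t, A t)) \<partial>tm) = \<infinity>"
  proof (rule ccontr)
    assume fin: "(\<integral>\<^sup>+t. ennreal (L (state_path T q A t, A t)) \<partial>tm) \<noteq> \<infinity>"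
    have "integrable tm (\<lambda>t. L (state_path T q A t, A t))"
    proof (rule integrableI_bounded)
      show "(\<lambda>t. L (state_path T q A t, A t)) \<in> borel_measurable tm"
        using A c by (intro L_path_measurable) auto
      show "(\<integral>\<^sup>+t. ennreal (norm (L (state_path T q A t, A t))) \<partial>tm) < \<infinity>"
        using fin by (simp add: L_nonneg less_top)
    qed
    then have "integrable tm (\<lambda>t. L (0, A t))"
      by (rule L_path_integrable_transfer[OF A c continuous_on_const])
    then show False using A not_adm by (simp add: admissible_def)
  qed
  then show ?thesis by (simp add: individual_cost_def)
qed

lemma traj_eq_state_path: "traj T Xs \<alpha> t \<omega> = state_path T (Xs \<omega>) (\<lambda>s. \<alpha> s \<omega>) t"
  by (simp add: traj_def state_path_def)

text \<open>The crowd enters only through averages over \<open>\<omega>\<close>, so at each time it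
  matters only up to a null set of labels. This covers the control actually played as well as a
  deviation from it.\<close>

lemma cost_eq_individual_cost:
  assumes X: "flow X" and A: "\<And>t. \<beta> t \<omega>0 = A t"
    and meas: "\<And>t. t \<in> {0..T} \<Longrightarrow> traj T Xs \<beta> t \<in> borel_measurable pm"
    and ae: "\<And>t. t \<in> {0..T} \<Longrightarrow> AE \<omega> in pm. traj T Xs \<beta> t \<omega> = X t \<omega>"
  shows "cost L \<Phi> \<Psi> T Xs \<omega>0 \<beta> = individual_cost X (Xs \<omega>0) A"
proof -
  have path: "traj T Xs \<beta> t \<omega>0 = state_path T (Xs \<omega>0) A t" for t
    by (simp add: traj_eq_state_path A)
  have avg: "(LINT \<omega>:players|lebesgue. f (x - traj T Xs \<beta> t \<omega>)) = (\<integral>\<omega>. f (x - X t \<omega>) \<partial>pm)"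
    if t: "t \<in> {0..T}" and [measurable]: "f \<in> borel_measurable borel" for f :: "'a \<Rightarrow> real" and t x
  proof -
    note meas[OF t, measurable] flow_measurable[OF X t, measurable]
    have "(\<integral>\<omega>. f (x - traj T Xs \<beta> t \<omega>) \<partial>pm) = (\<integral>\<omega>. f (x - X t \<omega>) \<partial>pm)"
    proof (rule integral_cong_AE)
      show "AE \<omega> in pm. f (x - traj T Xs \<beta> t \<omega>) = f (x - X t \<omega>)"
        using ae[OF t] by eventually_elim simp
    qed measurable
    then show ?thesis by (simp add: set_integral_eq_lebesgue_on)
  qed
  have "(LINT t:{0..T}|lebesgue. LINT \<omega>:players|lebesgue. \<Phi> (traj T Xs \<beta> t \<omega>0 - traj T Xs \<beta> t \<omega>))
      = (\<integral>t. running X t (state_path T (Xs \<omega>0) A t) \<partial>tm)"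
    unfolding path using avg[OF _ \<Phi>_measurable]
    by (subst set_integral_eq_lebesgue_on) (auto simp: running_def intro!: Bochner_Integration.integral_cong)
  moreover have "(LINT \<omega>:players|lebesgue. \<Psi> (traj T Xs \<beta> 0 \<omega>0 - traj T Xs \<beta> 0 \<omega>))
      = initial X (state_path T (Xs \<omega>0) A 0)"
    unfolding path initial_def by (rule avg[OF zero_in_time \<Psi>_measurable])
  moreover have "(\<integral>\<^sup>+t\<in>{0..T}. ennreal (L (traj T Xs \<beta> t \<omega>0, \<beta> t \<omega>0)) \<partial>lebesgue)
      = (\<integral>\<^sup>+t. ennreal (L (state_path T (Xs \<omega>0) A t, A t)) \<partial>tm)"
    unfolding path A by (subst nn_integral_restrict_space) auto
  ultimately show ?thesis by (simp add: cost_def individual_cost_def)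
qed

lemma Times_lmeasurable: "{0..T} \<times> players \<in> lmeasurable"
proof (rule bounded_set_imp_lmeasurable)
  show "bounded ({0..T} \<times> players)" by (intro bounded_Times) auto
  have "{0..T} \<times> players \<in> sets (borel \<Otimes>\<^sub>M borel)" by (rule pair_measureI) auto
  then show "{0..T} \<times> players \<in> sets lebesgue" unfolding borel_prod by auto
qed

lemma Xs_measurable: "Xs \<in> borel_measurable pm"
  using Xs_continuous by (intro continuous_imp_measurable_on_sets_lebesgue) (auto intro: continuous_on_subset)

lemma Xs_bounded: obtains b where "\<And>\<omega>. \<omega> \<in> {0..1} \<Longrightarrow> norm (Xs \<omega>) \<le> b"
proof -
  have "bounded (Xs ` {0..1})"
    by (intro compact_imp_bounded compact_continuous_image Xs_continuous) auto
  then obtain b where "\<forall>x\<in>Xs ` {0..1}. norm x \<le> b" unfolding bounded_iff by blast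
  then show ?thesis by (intro that[of b]) blast
qed

text \<open>On a set of finite measure, square integrability gives joint integrability; integrating
  sections then yields measurability in \<open>\<omega>\<close> and the dominating function
  \<open>h\<close>. Continuity in \<open>t\<close> comes from integrability of the control for every
  single label.\<close>

lemma collective_control_flow:
  assumes \<alpha>: "collective_control T \<alpha>"
  shows "flow (traj T Xs \<alpha>)"
proof -
  interpret pm: finite_measure pm by (rule finite_pm)
  let ?S = "{0..T} \<times> players"
  let ?M = "lebesgue_on ?S"
  interpret S: finite_measure ?M by (rule finite_measure_lebesgue_on[OF Times_lmeasurable])
  have m: "(\<lambda>p. \<alpha> (fst p) (snd p)) \<in> borel_measurable ?M"
    and i2: "integrable ?M (\<lambda>p. (norm (\<alpha> (fst p) (snd p)))\<^sup>2)"
    and i\<omega>: "\<omega> \<in> players \<Longrightarrow> integrable tm (\<lambda>t. \<alpha> t \<omega>)" for \<omega>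
    using \<alpha> unfolding collective_control_def case_prod_unfold
    by (auto simp: set_integrable_iff_lebesgue_on)
  have i1: "integrable ?M (\<lambda>p. \<alpha> (fst p) (snd p))"
  proof (rule Bochner_Integration.integrable_bound[OF _ m])
    show "integrable ?M (\<lambda>p. 1 + (norm (\<alpha> (fst p) (snd p)))\<^sup>2)" using i2 by simp
    have "norm (\<alpha> (fst p) (snd p)) \<le> norm (1 + (norm (\<alpha> (fst p) (snd p)))\<^sup>2)" for p
    proof -
      have "2 * norm v \<le> 1 + (norm v)\<^sup>2" for v :: 'a
        using zero_le_power2[of "norm v - 1"] by (simp add: power2_eq_square algebra_simps)
      from this[of "\<alpha> (fst p) (snd p)"] show ?thesis
        using norm_ge_zero[of "\<alpha> (fst p) (snd p)"] by (smt (verit) real_norm_def)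
    qed
    then show "AE p in ?M. norm (\<alpha> (fst p) (snd p)) \<le> norm (1 + (norm (\<alpha> (fst p) (snd p)))\<^sup>2)"
      by (rule AE_I2)
  qed
  have bor: "{0..T} \<in> sets borel" "players \<in> sets borel" by auto
  define h where "h \<omega> = norm (Xs \<omega>) + (\<integral>s. norm (\<alpha> s \<omega>) \<partial>tm)" for \<omega>
  have "integrable pm (\<lambda>\<omega>. \<integral>s. norm (\<alpha> s \<omega>) \<partial>tm)"
    using integrable_section_integral[OF bor integrable_norm[OF i1]] by simp
  moreover have "integrable pm (\<lambda>\<omega>. norm (Xs \<omega>))"
  proof -
    obtain b where "\<And>\<omega>. \<omega> \<in> {0..1} \<Longrightarrow> norm (Xs \<omega>) \<le> b" using Xs_bounded by blast
    then show ?thesis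
      using Xs_measurable by (intro pm.integrable_const_bound[of _ b] AE_I2) auto
  qed
  ultimately have "integrable pm h" by (simp add: h_def[abs_def])
  moreover have "norm (traj T Xs \<alpha> t \<omega>) \<le> h \<omega>" if "t \<in> {0..T}" "\<omega> \<in> players" for t \<omega>
  proof -
    have "norm (state_path T (Xs \<omega>) (\<lambda>s. \<alpha> s \<omega>) t - state_path T 0 (\<lambda>_. 0) t)
        \<le> norm (Xs \<omega> - 0) + (\<integral>s. norm (\<alpha> s \<omega> - 0) \<partial>tm)"
      using that i\<omega> by (intro state_path_diff) auto
    then show ?thesis by (simp add: traj_eq_state_path h_def) (simp add: state_path_def)
  qed
  moreover have "continuous_on {0..T} (\<lambda>t. traj T Xs \<alpha> t \<omega>)" if "\<omega> \<in> players" for \<omega>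
    unfolding traj_eq_state_path using continuous_on_state_path[OF i\<omega>[OF that]] by simp
  moreover have "traj T Xs \<alpha> t \<in> borel_measurable pm" if t: "t \<in> {0..T}" for t
  proof -
    \<comment> \<open>Cutting off by a strip turns the integral over \<open>{t..T}\<close> into a
      section integral over the full time interval.\<close>
    have "integrable ?M (\<lambda>p. indicat_real ({t..T} \<times> UNIV) p *\<^sub>R \<alpha> (fst p) (snd p))"
    proof (rule Bochner_Integration.integrable_bound[OF i1])
      have "{t..T} \<times> (UNIV :: real set) \<in> sets (borel \<Otimes>\<^sub>M borel)" by (rule pair_measureI) auto
      then have "{t..T} \<times> (UNIV :: real set) \<in> sets lebesgue" unfolding borel_prod by auto
      then have "indicat_real ({t..T} \<times> UNIV) \<in> borel_measurable ?M"
        by (intro measurable_restrict_space1 borel_measurable_indicator)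
      then show "(\<lambda>p. indicat_real ({t..T} \<times> UNIV) p *\<^sub>R \<alpha> (fst p) (snd p)) \<in> borel_measurable ?M"
        using m by (rule borel_measurable_scaleR)
    qed (auto simp: indicator_def)
    from integrable_section_integral[OF bor this]
    have "(\<lambda>\<omega>. \<integral>s. indicat_real {t..T} s *\<^sub>R \<alpha> s \<omega> \<partial>tm) \<in> borel_measurable pm"
      by (simp add: indicator_times)
    then have "(\<lambda>\<omega>. Xs \<omega> - (\<integral>s. indicat_real {t..T} s *\<^sub>R \<alpha> s \<omega> \<partial>tm)) \<in> borel_measurable pm"
      using Xs_measurable by (intro borel_measurable_diff)
    moreover have "traj T Xs \<alpha> t = (\<lambda>\<omega>. Xs \<omega> - (\<integral>s. indicat_real {t..T} s *\<^sub>R \<alpha> s \<omega> \<partial>tm))"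
      using t by (auto simp: traj_eq_state_path state_path_eq)
    ultimately show ?thesis by simp
  qed
  ultimately show ?thesis unfolding flow_def by blast
qed

lemma cost_self:
  assumes "collective_control T \<alpha>"
  shows "cost L \<Phi> \<Psi> T Xs \<omega>0 \<alpha> = individual_cost (traj T Xs \<alpha>) (Xs \<omega>0) (\<lambda>t. \<alpha> t \<omega>0)"
  using collective_control_flow[OF assms] by (intro cost_eq_individual_cost flow_measurable) auto

text \<open>Non-atomicity: a unilateral deviation is invisible to the other players.\<close>

lemma cost_deviate:
  assumes \<alpha>: "collective_control T \<alpha>"
  shows "cost L \<Phi> \<Psi> T Xs \<omega>0 (deviate Xs \<alpha> \<omega>0 A) = individual_cost (traj T Xs \<alpha>) (Xs \<omega>0) A"
proof (rule cost_eq_individual_cost)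
  let ?N = "{\<omega> \<in> players. Xs \<omega> = Xs \<omega>0}"
  have N: "?N \<in> null_sets pm"
    using Xs_nonatomic[of "Xs \<omega>0"] by (subst null_sets_restrict_space) auto
  have eq: "traj T Xs (deviate Xs \<alpha> \<omega>0 A) t = (\<lambda>\<omega>. if Xs \<omega> = Xs \<omega>0 then state_path T (Xs \<omega>0) A t else traj T Xs \<alpha> t \<omega>)" for t
    by (auto simp: traj_eq_state_path deviate_def fun_eq_iff)
  show F: "flow (traj T Xs \<alpha>)" by (rule collective_control_flow[OF \<alpha>])
  show "deviate Xs \<alpha> \<omega>0 A t \<omega>0 = A t" for t by (simp add: deviate_def)
  fix t assume t: "t \<in> {0..T}"
  show "traj T Xs (deviate Xs \<alpha> \<omega>0 A) t \<in> borel_measurable pm"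
    unfolding eq
  proof (rule measurable_If)
    show "{\<omega> \<in> space pm. Xs \<omega> = Xs \<omega>0} \<in> sets pm" using N by auto
  qed (use flow_measurable[OF F t] in auto)
  have "AE \<omega> in pm. \<omega> \<notin> ?N" using N by (rule AE_not_in)
  moreover have "AE \<omega> in pm. \<omega> \<in> players" by (rule AE_I2) simp
  ultimately show "AE \<omega> in pm. traj T Xs (deviate Xs \<alpha> \<omega>0 A) t \<omega> = traj T Xs \<alpha> t \<omega>"
    by eventually_elim (simp add: eq)
qed

lemma nash_equilibrium_iff_optimal:
  assumes \<alpha>: "collective_control T \<alpha>"
  shows "nash_equilibrium L \<Phi> \<Psi> T Xs \<alpha> \<longleftrightarrow>
    (\<forall>\<omega>\<in>players. optimal (traj T Xs \<alpha>) (Xs \<omega>) (\<lambda>t. \<alpha> t \<omega>))"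
proof -
  define X where "X = traj T Xs \<alpha>"
  have i: "integrable tm (\<lambda>t. \<alpha> t \<omega>)" if "\<omega> \<in> players" for \<omega>
    using \<alpha> that by (auto simp: collective_control_def set_integrable_iff_lebesgue_on)
  have "(\<forall>A. integrable tm A \<longrightarrow>
        individual_cost X (Xs \<omega>) (\<lambda>t. \<alpha> t \<omega>) \<le> individual_cost X (Xs \<omega>) A)
      \<longleftrightarrow> optimal X (Xs \<omega>) (\<lambda>t. \<alpha> t \<omega>)" (is "?nash \<longleftrightarrow> _") if \<omega>: "\<omega> \<in> players" for \<omega>
  proof
    assume nash: ?nash
    \<comment> \<open>The zero control has finite cost, which forces the equilibrium control to be
      admissible.\<close>
    then have "individual_cost X (Xs \<omega>) (\<lambda>t. \<alpha> t \<omega>) \<le> individual_cost X (Xs \<omega>) (\<lambda>_. 0)" by simp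
    then have adm: "admissible (\<lambda>t. \<alpha> t \<omega>)"
      using individual_cost_not_admissible[OF i[OF \<omega>]] individual_cost_admissible[OF admissible_zero]
      by (metis ereal_infty_less_eq(1) PInfty_neq_ereal(1))
    have "J X (Xs \<omega>) (\<lambda>t. \<alpha> t \<omega>) \<le> J X (Xs \<omega>) B" if "admissible B" for B
    proof -
      have "integrable tm B" using that by (simp add: admissible_def)
      then show ?thesis
        using nash that adm individual_cost_admissible by (metis ereal_less_eq(3))
    qed
    then show "optimal X (Xs \<omega>) (\<lambda>t. \<alpha> t \<omega>)" using adm by (simp add: optimal_def)
  next
    assume opt: "optimal X (Xs \<omega>) (\<lambda>t. \<alpha> t \<omega>)"
    show ?nash
    proof (intro allI impI)
      fix A :: "real \<Rightarrow> 'a" assume "integrable tm A"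
      then show "individual_cost X (Xs \<omega>) (\<lambda>t. \<alpha> t \<omega>) \<le> individual_cost X (Xs \<omega>) A"
        using opt individual_cost_not_admissible[of A X "Xs \<omega>"]
        by (cases "admissible A") (auto simp: optimal_def individual_cost_admissible)
    qed
  qed
  then show ?thesis
    using \<alpha> by (auto simp: nash_equilibrium_def cost_self[OF \<alpha>] cost_deviate[OF \<alpha>] X_def set_integrable_iff_lebesgue_on)
qed

text \<open>With \<open>S\<close> the supremum over time of the mean distance of the two crowds, the
  comparison of optimal controls gives \<open>S \<le> 2 / 3 * S\<close>. Working with means requires
  no bound on trajectories that is uniform in the label.\<close>

theorem nash_equilibrium_unique:
  assumes \<alpha>: "nash_equilibrium L \<Phi> \<Psi> T Xs \<alpha>" and \<beta>: "nash_equilibrium L \<Phi> \<Psi> T Xs \<beta>"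
  shows "control_equiv T \<alpha> \<beta>"
proof -
  interpret pm: finite_measure pm by (rule finite_pm)
  define X Y where "X = traj T Xs \<alpha>" and "Y = traj T Xs \<beta>"
  have cc: "collective_control T \<alpha>" "collective_control T \<beta>"
    using \<alpha> \<beta> by (auto simp: nash_equilibrium_def)
  have X: "flow X" and Y: "flow Y" unfolding X_def Y_def by (intro collective_control_flow cc)+
  have optX: "optimal X (Xs \<omega>) (\<lambda>t. \<alpha> t \<omega>)" and optY: "optimal Y (Xs \<omega>) (\<lambda>t. \<beta> t \<omega>)"
    if "\<omega> \<in> players" for \<omega>
    using \<alpha> \<beta> that unfolding nash_equilibrium_iff_optimal[OF cc(1)] nash_equilibrium_iff_optimal[OF cc(2)] X_def Y_def
    by auto
  define D where "D t = (\<integral>\<omega>. norm (X t \<omega> - Y t \<omega>) \<partial>pm)" for t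
  define S where "S = (SUP t\<in>{0..T}. D t)"
  have XYi: "integrable pm (\<lambda>\<omega>. norm (X t \<omega> - Y t \<omega>))" if "t \<in> {0..T}" for t
    using flow_integrable[OF X that] flow_integrable[OF Y that] by simp
  obtain h where h: "integrable pm h" "\<forall>t\<in>{0..T}. \<forall>\<omega>\<in>players. norm (X t \<omega>) \<le> h \<omega>"
    using X unfolding flow_def by (elim conjE exE)
  obtain k where k: "integrable pm k" "\<forall>t\<in>{0..T}. \<forall>\<omega>\<in>players. norm (Y t \<omega>) \<le> k \<omega>"
    using Y unfolding flow_def by (elim conjE exE)
  have "D t \<le> (\<integral>\<omega>. h \<omega> + k \<omega> \<partial>pm)" if "t \<in> {0..T}" for t
    unfolding D_def
  proof (rule integral_mono)
    fix \<omega> assume "\<omega> \<in> space pm"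
    then show "norm (X t \<omega> - Y t \<omega>) \<le> h \<omega> + k \<omega>"
      using h(2)[rule_format, OF that, of \<omega>] k(2)[rule_format, OF that, of \<omega>] norm_triangle_ineq4[of "X t \<omega>" "Y t \<omega>"] by simp
  qed (use XYi that h k in auto)
  \<comment> \<open>Without boundedness the real supremum \<open>S\<close> would say nothing about
    \<open>D\<close>; it comes from the two integrable dominating functions.\<close>
  then have "bdd_above (D ` {0..T})" by (rule bdd_aboveI2)
  then have DS: "D t \<le> S" if "t \<in> {0..T}" for t
    unfolding S_def using that by (rule cSUP_upper[rotated])
  have step: "sqrt (T * energy (\<lambda>t. \<alpha> t \<omega>) (\<lambda>t. \<beta> t \<omega>)) \<le> 2 / 3 * S" if "\<omega> \<in> players" for \<omega>
    using DS by (intro optimal_flow_comparison[OF X Y _ optX[OF that] optY[OF that]]) (simp add: D_def)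
  have "D t \<le> 2 / 3 * S" if t: "t \<in> {0..T}" for t
  proof -
    have "D t \<le> (\<integral>\<omega>. 2 / 3 * S \<partial>pm)"
      unfolding D_def
    proof (rule integral_mono)
      fix \<omega> assume "\<omega> \<in> space pm"
      then have \<omega>: "\<omega> \<in> players" by simp
      have "norm (X t \<omega> - Y t \<omega>) \<le> sqrt (T * energy (\<lambda>t. \<alpha> t \<omega>) (\<lambda>t. \<beta> t \<omega>))"
        unfolding X_def Y_def traj_eq_state_path using t optX[OF \<omega>] optY[OF \<omega>]
        by (intro real_le_rsqrt path_diff_energy) (auto simp: optimal_def)
      then show "norm (X t \<omega> - Y t \<omega>) \<le> 2 / 3 * S" using step[OF \<omega>] by simp
    qed (use XYi t in auto)
    then show ?thesis by (simp add: measure_pm)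
  qed
  then have "S \<le> 2 / 3 * S"
    unfolding S_def using T_pos by (intro cSUP_least) auto
  then have "S \<le> 0" by simp
  \<comment> \<open>The estimate \<open>step\<close> holds for each individual label, so vanishing
    crowd distance gives equality of controls for every label and not merely for almost every
    one.\<close>
  show ?thesis
    unfolding control_equiv_def
  proof
    fix \<omega> assume \<omega>: "\<omega> \<in> players"
    have adm: "admissible (\<lambda>t. \<alpha> t \<omega>)" "admissible (\<lambda>t. \<beta> t \<omega>)"
      using optX[OF \<omega>] optY[OF \<omega>] by (auto simp: optimal_def)
    have "sqrt (T * energy (\<lambda>t. \<alpha> t \<omega>) (\<lambda>t. \<beta> t \<omega>)) \<le> 0" using step[OF \<omega>] \<open>S \<le> 0\<close> by linarith
    then have "energy (\<lambda>t. \<alpha> t \<omega>) (\<lambda>t. \<beta> t \<omega>) = 0"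
      using T_pos energy_nonneg[of "\<lambda>t. \<alpha> t \<omega>" "\<lambda>t. \<beta> t \<omega>"] by (simp add: mult_le_0_iff)
    then have "AE t in tm. (norm (\<alpha> t \<omega> - \<beta> t \<omega>))\<^sup>2 = 0"
      using integral_nonneg_eq_0_iff_AE[OF admissible_diff_square_integrable[OF adm]]
      by (simp add: energy_def)
    then show "AE t in tm. \<alpha> t \<omega> = \<beta> t \<omega>" by eventually_elim simp
  qed
qed

text \<open>Comparison with the zero control bounds the optimal cost affinely in
  \<open>norm q\<close>. As \<open>Xs\<close> is bounded, this becomes a bound uniform in the label,
  which makes the selected control jointly square integrable.\<close>

lemma optimal_square_integral_le:
  assumes X: "flow X" and A: "optimal X q A"
  shows "c0 * (\<integral>t. (norm (A t))\<^sup>2 \<partial>tm) \<le> J X 0 (\<lambda>_. 0) + (T * c1 + T * l + l) * norm q - (T * m + m)"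
proof -
  have adm: "admissible A" using A by (simp add: optimal_def)
  have "c0 * (\<integral>t. (norm (A t))\<^sup>2 \<partial>tm) = (\<integral>t. c0 * (norm (A t))\<^sup>2 \<partial>tm)" by simp
  also have "\<dots> \<le> (\<integral>t. L (state_path T q A t, A t) \<partial>tm)"
    using admissible_square_integrable[OF adm] admissible_path_integrable[OF adm]
    by (intro integral_mono L_coercive) auto
  also have "\<dots> \<le> J X q A - (T * m + m)" using J_ge[OF X adm, of q] by simp
  also have "J X q A \<le> J X q (\<lambda>_. 0)" using A admissible_zero by (simp add: optimal_def)
  also have "J X q (\<lambda>_. 0) \<le> J X 0 (\<lambda>_. 0) + (T * c1 + T * l + l) * norm q"
    using J_shift[OF X admissible_zero, of q 0] by simp
  finally show ?thesis by simp
qed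

lemma J_cong_flow:
  assumes "\<And>t \<omega>. t \<in> {0..T} \<Longrightarrow> \<omega> \<in> players \<Longrightarrow> X t \<omega> = Y t \<omega>"
  shows "J X q A = J Y q A"
proof -
  have r: "running X t x = running Y t x" if "t \<in> {0..T}" for t x
    unfolding running_def using assms that by (intro Bochner_Integration.integral_cong) auto
  have "initial X x = initial Y x" for x
    unfolding initial_def using assms zero_in_time by (intro Bochner_Integration.integral_cong) auto
  moreover have "(\<integral>t. running X t (state_path T q A t) \<partial>tm) = (\<integral>t. running Y t (state_path T q A t) \<partial>tm)"
    using r by (intro Bochner_Integration.integral_cong) auto
  ultimately show ?thesis by (simp add: J_def)
qed

text \<open>The measurable selection agrees with the optimal controls of the fixed point up to null
  sets of times, label by label. It therefore stays optimal and reproduces the fixed-point flow as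
  its own trajectories.\<close>

theorem nash_equilibrium_exists: "\<exists>\<alpha>. nash_equilibrium L \<Phi> \<Psi> T Xs \<alpha>"
proof -
  obtain X B where X: "flow X" and B: "\<And>\<omega>. \<omega> \<in> {0..1} \<Longrightarrow> optimal X (Xs \<omega>) (B \<omega>)"
    and XB: "\<And>t \<omega>. t \<in> {0..T} \<Longrightarrow> \<omega> \<in> {0..1} \<Longrightarrow> X t \<omega> = state_path T (Xs \<omega>) (B \<omega>) t"
    using equilibrium_flow_exists[OF Xs_continuous] by metis
  obtain \<alpha> where m: "(\<lambda>(t, \<omega>). \<alpha> t \<omega>) \<in> borel_measurable borel"
    and ae: "\<And>\<omega>. \<omega> \<in> players \<Longrightarrow> AE t in tm. B \<omega> t = \<alpha> t \<omega>"
    using measurable_optimal_selection[OF X Xs_continuous B] by metis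
  have iB: "integrable tm (B \<omega>)" if "\<omega> \<in> players" for \<omega>
    using B[of \<omega>] that by (auto simp: optimal_def admissible_def)
  have m\<omega>: "(\<lambda>t. \<alpha> t \<omega>) \<in> borel_measurable tm" for \<omega>
  proof -
    have "(\<lambda>t. (t, \<omega>)) \<in> borel_measurable borel" by (intro borel_measurable_continuous_onI continuous_intros)
    from measurable_compose[OF this m] have "(\<lambda>t. \<alpha> t \<omega>) \<in> borel_measurable lborel" by simp
    then show ?thesis by (intro measurable_restrict_space1 measurable_completion)
  qed
  have i\<omega>: "integrable tm (\<lambda>t. \<alpha> t \<omega>)" if "\<omega> \<in> players" for \<omega>
    using iB[OF that] ae[OF that] m\<omega> by (subst integrable_cong_AE[of _ _ "B \<omega>"]) auto
  have opt: "optimal X (Xs \<omega>) (\<lambda>t. \<alpha> t \<omega>)" if "\<omega> \<in> players" for \<omega>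
    using that by (intro optimal_cong_AE[OF B i\<omega> ae]) auto
  obtain b where b: "\<And>\<omega>. \<omega> \<in> {0..1} \<Longrightarrow> norm (Xs \<omega>) \<le> b" using Xs_bounded by blast
  define K where "K = (J X 0 (\<lambda>_. 0) + (T * c1 + T * l + l) * b - (T * m + m)) / c0"
  have K: "(\<integral>t. (norm (\<alpha> t \<omega>))\<^sup>2 \<partial>tm) \<le> K" if "\<omega> \<in> players" for \<omega>
  proof -
    have "(T * c1 + T * l + l) * norm (Xs \<omega>) \<le> (T * c1 + T * l + l) * b"
      using b[of \<omega>] that T_pos c1_nonneg l_nonneg by (intro mult_left_mono) auto
    then show ?thesis
      unfolding K_def using optimal_square_integral_le[OF X opt[OF that]] c0_pos by (simp add: field_simps)
  qed
  let ?S = "{0..T} \<times> players"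
  have cc: "collective_control T \<alpha>"
    unfolding collective_control_def
  proof (intro conjI ballI)
    show mS: "(\<lambda>(t, \<omega>). \<alpha> t \<omega>) \<in> borel_measurable (lebesgue_on ?S)"
      using m by (intro measurable_restrict_space1 measurable_completion) simp
    have m2: "(\<lambda>p. ennreal (norm ((norm (\<alpha> (fst p) (snd p)))\<^sup>2))) \<in> borel_measurable borel"
      using m unfolding case_prod_unfold by simp
    show "integrable (lebesgue_on ?S) (\<lambda>(t, \<omega>). (norm (\<alpha> t \<omega>))\<^sup>2)"
      unfolding case_prod_unfold
    proof (rule integrableI_bounded)
      show "(\<lambda>p. (norm (\<alpha> (fst p) (snd p)))\<^sup>2) \<in> borel_measurable (lebesgue_on ?S)"
        using mS unfolding case_prod_unfold by simp
      have "(\<integral>\<^sup>+p. ennreal (norm ((norm (\<alpha> (fst p) (snd p)))\<^sup>2)) \<partial>lebesgue_on ?S)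
          = (\<integral>\<^sup>+\<omega>. (\<integral>\<^sup>+t. ennreal ((norm (\<alpha> t \<omega>))\<^sup>2) \<partial>tm) \<partial>pm)"
        using nn_integral_lebesgue_on_Times[OF _ _ m2, of "{0..T}" players] by simp
      also have "\<dots> \<le> (\<integral>\<^sup>+\<omega>. ennreal K \<partial>pm)"
      proof (rule nn_integral_mono)
        fix \<omega> assume "\<omega> \<in> space pm"
        then have \<omega>: "\<omega> \<in> players" by simp
        have adm: "admissible (\<lambda>t. \<alpha> t \<omega>)" using opt[OF \<omega>] by (simp add: optimal_def)
        have "(\<integral>\<^sup>+t. ennreal ((norm (\<alpha> t \<omega>))\<^sup>2) \<partial>tm) = ennreal (\<integral>t. (norm (\<alpha> t \<omega>))\<^sup>2 \<partial>tm)"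
          by (rule nn_integral_eq_integral[OF admissible_square_integrable[OF adm]]) simp
        also have "\<dots> \<le> ennreal K" by (rule ennreal_leI[OF K[OF \<omega>]])
        finally show "(\<integral>\<^sup>+t. ennreal ((norm (\<alpha> t \<omega>))\<^sup>2) \<partial>tm) \<le> ennreal K" .
      qed
      also have "\<dots> < \<infinity>" by (simp add: emeasure_restrict_space ennreal_mult_less_top)
      finally show "(\<integral>\<^sup>+p. ennreal (norm ((norm (\<alpha> (fst p) (snd p)))\<^sup>2)) \<partial>lebesgue_on ?S) < \<infinity>" .
    qed
    show "set_integrable lebesgue {0..T} (\<lambda>t. \<alpha> t \<omega>)" if "\<omega> \<in> players" for \<omega>
      using i\<omega>[OF that] by (simp add: set_integrable_iff_lebesgue_on)
  qed
  have "traj T Xs \<alpha> t \<omega> = X t \<omega>" if "t \<in> {0..T}" "\<omega> \<in> players" for t \<omega>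
  proof -
    have "state_path T (Xs \<omega>) (B \<omega>) t = state_path T (Xs \<omega>) (\<lambda>s. \<alpha> s \<omega>) t"
      using that by (intro state_path_cong_AE ae iB i\<omega>) auto
    then show ?thesis using XB[of t \<omega>] that by (simp add: traj_eq_state_path)
  qed
  then have "J (traj T Xs \<alpha>) q A = J X q A" for q A
    by (intro J_cong_flow) auto
  then have "nash_equilibrium L \<Phi> \<Psi> T Xs \<alpha>"
    unfolding nash_equilibrium_iff_optimal[OF cc] using opt by (simp add: optimal_def)
  then show ?thesis by blast
qed

end

section \<open>From the standing assumptions to the abstract game\<close>

lemma smallness_condition_real:
  fixes hP hQ :: ereal
  assumes le: "ereal (T\<^sup>2) * (ereal a + 2 * hP) + ereal T * (ereal b + 2 * hQ) < ereal (lam / 2)"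
    and T: "T > 0" and nonneg: "0 \<le> a" "0 \<le> b" "0 \<le> hP" "0 \<le> hQ"
  obtains MP MQ where "hP = ereal MP" "hQ = ereal MQ" "0 \<le> MP" "0 \<le> MQ" "T\<^sup>2 * MP + T * MQ \<le> lam / 4"
proof -
  \<comment> \<open>All terms are nonnegative and \<open>T\<close> is positive, so one infinite
    Hessian norm would make the left side infinite.\<close>
  have finite: "hP \<noteq> \<infinity>" "hQ \<noteq> \<infinity>"
    using le T nonneg by (cases hP; cases hQ; simp)+
  then obtain MP MQ where M: "hP = ereal MP" "hQ = ereal MQ"
    using nonneg by (cases hP; cases hQ) auto
  have "T\<^sup>2 * (a + 2 * MP) + T * (b + 2 * MQ) < lam / 2"
    using le by (simp add: M)
  moreover have "0 \<le> T\<^sup>2 * a" "0 \<le> T * b" using T nonneg by simp_all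
  \<comment> \<open>The terms with \<open>a\<close> and \<open>b\<close> only enlarge the left side,
    and the factor 2 in front of the Hessian norms turns \<open>lam / 2\<close> into
    \<open>lam / 4\<close>.\<close>
  ultimately have "T\<^sup>2 * MP + T * MQ \<le> lam / 4" by (simp add: algebra_simps)
  then show ?thesis using that M nonneg by simp
qed

theorem mainTheorem1:
  fixes L H :: "(real ^ 'd) \<times> (real ^ 'd) \<Rightarrow> real"
    and \<Phi> \<Psi> :: "real ^ 'd \<Rightarrow> real"
    and c0 c1 lam0 c\<Phi> c\<Psi> T :: real
    and Xs :: "real \<Rightarrow> real ^ 'd"
  assumes "Ck 3 L" and "Ck 3 H"
    and "legendre_snd L H" and "legendre_snd H L"
    and "\<forall>q v. L (q, v) \<ge> 0"
    and "c0 > 0" and "\<forall>q v. c0 * (norm v)\<^sup>2 \<le> L (q, v)"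
    and "c1 > 0" and "\<forall>q v. norm (grad (\<lambda>x. L (x, v)) q) \<le> c1"
    and "lam0 > 0"
    and "\<forall>q0 q1 v0 v1. \<forall>\<epsilon>\<in>{0..1}.
           lam0 * (norm (v1 - v0))\<^sup>2 \<le>
             deriv (deriv (\<lambda>e. L ((1 - e) *\<^sub>R q0 + e *\<^sub>R q1, (1 - e) *\<^sub>R v0 + e *\<^sub>R v1))) \<epsilon>"
    and "Ck 3 \<Phi>" and "\<forall>x. \<Phi> (- x) = \<Phi> x" and "\<exists>m. \<forall>x. m \<le> \<Phi> x"
    and "bounded_derivs_upto 3 \<Phi>" and "hess_ge c\<Phi> \<Phi>"
    and "Ck 3 \<Psi>" and "\<forall>x. \<Psi> (- x) = \<Psi> x" and "\<exists>m. \<forall>x. m \<le> \<Psi> x"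
    and "bounded_derivs_upto 3 \<Psi>" and "hess_ge c\<Psi> \<Psi>"
    and "lifted_lagrangian_finite L \<Phi>"
    and "T > 0"
    and "ereal (T\<^sup>2) * (ereal (neg_part c\<Phi>) + 2 * hess_Linfty \<Phi>) +
         ereal T * (ereal (neg_part c\<Psi>) + 2 * hess_Linfty \<Psi>) < ereal (lam0 / 2)"
    and "L2_players Xs" and "C1_unit_interval Xs"
    and "\<forall>q. {\<omega> \<in> players. Xs \<omega> = q} \<in> null_sets lebesgue"
  shows "(\<exists>\<alpha>. nash_equilibrium L \<Phi> \<Psi> T Xs \<alpha>) \<and>
         (\<forall>\<alpha> \<beta>. nash_equilibrium L \<Phi> \<Psi> T Xs \<alpha> \<and> nash_equilibrium L \<Phi> \<Psi> T Xs \<beta>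
            \<longrightarrow> control_equiv T \<alpha> \<beta>)"
proof -
  have three: "3 = Suc (Suc (Suc 0))" by simp
  note L3 = assms(1)[unfolded three] and P3 = assms(12)[unfolded three] and Q3 = assms(17)[unfolded three]
  obtain MP MQ where M: "hess_Linfty \<Phi> = ereal MP" "hess_Linfty \<Psi> = ereal MQ" "0 \<le> MP" "0 \<le> MQ"
    and small: "T\<^sup>2 * MP + T * MQ \<le> lam0 / 4"
    using smallness_condition_real[OF assms(24) assms(23) _ _ hess_Linfty_nonneg[OF P3] hess_Linfty_nonneg[OF Q3]]
    by (auto simp: neg_part_def)
  obtain lP where lP: "0 \<le> lP" "\<And>x y. \<bar>\<Phi> x - \<Phi> y\<bar> \<le> lP * norm (x - y)"
    using bounded_derivs_imp_Lipschitz[OF P3 assms(15)] by auto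
  obtain lQ where lQ: "0 \<le> lQ" "\<And>x y. \<bar>\<Psi> x - \<Psi> y\<bar> \<le> lQ * norm (x - y)"
    using bounded_derivs_imp_Lipschitz[OF Q3 assms(20)] by auto
  obtain mP mQ where m: "\<And>x. mP \<le> \<Phi> x" "\<And>x. mQ \<le> \<Psi> x"
    using assms(14,19) by auto
  have diff2: "\<bar>f (y2 - x1) - f (y2 - x2) - (f (y1 - x1) - f (y1 - x2))\<bar> \<le> K * norm (y1 - y2) * norm (x1 - x2)"
    if C: "Ck (Suc (Suc (Suc 0))) f" and K: "hess_Linfty f = ereal K"
    for f :: "real ^ 'd \<Rightarrow> real" and K x1 x2 y1 y2
  proof (rule second_difference_bound[where g = "grad f"])
    show "GDERIV f x :> grad f x" for x
      using C by (intro GDERIV_grad) simp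
    show "norm (grad f x - grad f y) \<le> K * norm (x - y)" for x y
      by (rule hess_Linfty_Lipschitz_grad[OF C]) (simp add: K)
  qed
  have L_lip: "\<bar>L (q, v) - L (q', v)\<bar> \<le> c1 * norm (q - q')" for q q' v
  proof (rule bounded_gradient_imp_Lipschitz[where f = "\<lambda>x. L (x, v)" and g = "grad (\<lambda>x. L (x, v))"])
    have "(\<lambda>x. L (x, v)) differentiable (at x)" for x
      using L3 by (intro differentiable_compose[of L "\<lambda>x. (x, v)"]) (auto intro!: derivative_intros)
    then show "GDERIV (\<lambda>x. L (x, v)) x :> grad (\<lambda>x. L (x, v)) x" for x
      by (rule GDERIV_grad)
    show "norm (grad (\<lambda>x. L (x, v)) x) \<le> c1" for x using assms(9) by blast
  qed
  \<comment> \<open>The second derivative is taken along a segment of the product space, with a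
    lower bound that depends on the velocities only: strong convexity in \<open>v\<close>, jointly
    with convexity in \<open>q\<close>.\<close>
  have L_mid: "L ((1/2) *\<^sub>R (q0 + q1), (1/2) *\<^sub>R (v0 + v1))
      \<le> (L (q0, v0) + L (q1, v1)) / 2 - lam0 / 8 * (norm (v0 - v1))\<^sup>2" for q0 q1 v0 v1
    using midpoint_strong_convexity[OF L3, of "lam0 * (norm (v1 - v0))\<^sup>2" "(q0, v0)" "(q1, v1)"] assms(11)
    by (simp add: norm_minus_commute)
  have Xs_cont: "continuous_on {0..1} Xs"
    using assms(26) unfolding C1_unit_interval_def
    by (auto simp: continuous_on_eq_continuous_within intro: has_vector_derivative_continuous)
  \<comment> \<open>One Lipschitz constant and one lower bound must serve both potentials, hence the
    maximum and the minimum.\<close>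
  interpret mfg_game L \<Phi> \<Psi> c0 c1 lam0 "max lP lQ" "min mP mQ" MP MQ T Xs
  proof
    show "continuous_on UNIV L" by (rule Ck_Suc_continuous[OF L3])
    show "0 \<le> c1" using assms(8) by simp
    show "0 \<le> max lP lQ" using lP by simp
    show "\<bar>\<Phi> x - \<Phi> y\<bar> \<le> max lP lQ * norm (x - y)" for x y
      using lP(2)[of x y] by (rule order_trans) (intro mult_right_mono; simp)
    show "\<bar>\<Psi> x - \<Psi> y\<bar> \<le> max lP lQ * norm (x - y)" for x y
      using lQ(2)[of x y] by (rule order_trans) (intro mult_right_mono; simp)
    show "min mP mQ \<le> \<Phi> x" "min mP mQ \<le> \<Psi> x" for x
      using m[of x] by auto
  qed (use assms M small L_lip L_mid Xs_cont diff2[OF P3 M(1)] diff2[OF Q3 M(2)] in auto)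
  show ?thesis
    using nash_equilibrium_exists nash_equilibrium_unique by blast
qed

end
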